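(* Let $\alpha>-1$. For $\max\{|cu|,|cv|,|du|,|dv|,|bzu|,|bzv|\}<1$, we have $$\int_u^v\frac{(qx/u,qx/v;q)_\infty}{(cx,dx;q)_\infty}\,\mathbb{T}(\beta,y;\mathcal{D}_{q,z})\left\{\frac{1}{(bzx;q)_\infty}\,{}_0\phi_1\left(\begin{gathered}-\\ q^{\alpha+1}\end{gathered};\,q,\,-q^{\alpha+1}azx\right)\right\}d_qx$$ $$=\frac{(1-q)v\,(q,u/v,qv/u,cduv;q)_\infty}{(cu,cv,du,dv;q)_\infty}\sum_{n=0}^\infty\frac{W_n(c,d,u,v)\,\Psi_n^{(\beta)}(y,z)}{(q;q)_n}\,L_n^{(\alpha)}(a,b),$$ where $\mathbb{T}(\beta,y;\mathcal{D}_{q,z})=\sum_{k=0}^\infty\frac{(\beta;q)_k}{(q;q)_k}(y\mathcal{D}_{q,z})^k$ is the Cauchy augmentation operator.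
   Context: Fix $q$ with $0<|q|<1$; real powers $q^{s}$ are taken with respect to a fixed choice of $\log q$. $(a;q)_0=1$, $(a;q)_n=\prod_{i=0}^{n-1}(1-aq^i)$, $(a;q)_\infty=\prod_{i\ge0}(1-aq^i)$, $(a_1,\dots,a_r;q)_n=(a_1;q)_n\cdots(a_r;q)_n$ (also for $n=\infty$), $\begin{bmatrix} n\\ k\end{bmatrix}=\frac{(q;q)_n}{(q;q)_k(q;q)_{n-k}}$. The Jackson $q$-integral is $\int_a^b f(x)\,d_qx=(1-q)\sum_{n=0}^\infty[bf(bq^n)-af(aq^n)]q^n$. The $q$-partial derivative in $z$ is $\mathcal{D}_{q,z}\{f\}=\frac{f(z)-f(qz)}{z}$, the other variables being regarded as constants, so that $(y\mathcal{D}_{q,z})^k=y^k\mathcal{D}_{q,z}^k$. ${}_0\phi_1\left(\begin{gathered}-\\ b\end{gathered};q,w\right)=\sum_{n=0}^\infty\frac{q^{n(n-1)}w^n}{(b;q)_n(q;q)_n}$. Polynomials: $L_n^{(\alpha)}(x,y)=\sum_{k=0}^n\begin{bmatrix} n\\ k\end{bmatrix}\frac{q^{k^2+k\alpha}}{(q^{\alpha+1};q)_k}(-x)^ky^{n-k}$ (homogeneous $q$-Laguerre, defined for $\alpha>-1$), $\Psi_n^{(\beta)}(x,y)=\sum_{k=0}^n\begin{bmatrix} n\\ k\end{bmatrix}(\beta;q)_kx^ky^{n-k}$ (homogeneous Hahn), and $W_n(a,b,u,v)=\sum_{k=0}^n\begin{bmatrix} n\\ k\end{bmatrix}\frac{(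av,bv;q)_k}{(abuv;q)_k}u^kv^{n-k}$.
   Formalization: Added: u, v nonzero, and either |byu|, |byv| < 1 or convergence of the operator series T at every point where the q-integral evaluates it (else it may diverge, e.g. a = β = z = 0, |byu| ≥ 1); the q-derivative at z = 0 is taken by continuity. *)

theory Defs
  imports "HOL-Analysis.Analysis"
begin

(* The base q is complex. A choice of log q is a complex number lq with exp lq = q. *)
definition qpowr :: "complex \<Rightarrow> real \<Rightarrow> complex" where
  "qpowr lq s = exp (of_real s * lq)"

definition qpoch :: "complex \<Rightarrow> complex \<Rightarrow> nat \<Rightarrow> complex" where
  "qpoch q a n = (\<Prod>i<n. 1 - a * q ^ i)"

(* For norm q < 1 this product converges for every a, and is 0 iff a factor vanishes. *)
definition qpoch_inf :: "complex \<Rightarrow> complex \<Rightarrow> complex" where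
  "qpoch_inf q a = (\<Prod>i. 1 - a * q ^ i)"

definition qbinom :: "complex \<Rightarrow> nat \<Rightarrow> nat \<Rightarrow> complex" where
  "qbinom q n k = qpoch q q n / (qpoch q q k * qpoch q q (n - k))"

definition jackson_term :: "complex \<Rightarrow> complex \<Rightarrow> complex \<Rightarrow> (complex \<Rightarrow> complex) \<Rightarrow> nat \<Rightarrow> complex" where
  "jackson_term q a b f n = (b * f (b * q ^ n) - a * f (a * q ^ n)) * q ^ n"

definition jackson_integrable :: "complex \<Rightarrow> complex \<Rightarrow> complex \<Rightarrow> (complex \<Rightarrow> complex) \<Rightarrow> bool" where
  "jackson_integrable q a b f \<longleftrightarrow> summable (jackson_term q a b f)"

definition jackson_integral :: "complex \<Rightarrow> complex \<Rightarrow> complex \<Rightarrow> (complex \<Rightarrow> complex) \<Rightarrow> complex" where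
  "jackson_integral q a b f = (1 - q) * (\<Sum>n. jackson_term q a b f n)"

(* The points at which the Jackson integral from a to b evaluates its integrand. *)
definition jackson_nodes :: "complex \<Rightarrow> complex \<Rightarrow> complex \<Rightarrow> complex set" where
  "jackson_nodes q a b = range (\<lambda>n. a * q ^ n) \<union> range (\<lambda>n. b * q ^ n)"

(* The quotient is undefined at z = 0; there it is extended by continuity, so that
   z ^ n is sent to (1 - q ^ n) * z ^ (n - 1) at every z. There is no factor 1 / (1 - q). *)
definition qderiv :: "complex \<Rightarrow> (complex \<Rightarrow> complex) \<Rightarrow> complex \<Rightarrow> complex" where
  "qderiv q f z =
     (if z = 0 then Lim (at 0) (\<lambda>w. (f w - f (q * w)) / w)
      else (f z - f (q * z)) / z)"

(* The term of index k of T(beta, y; D_{q,z}){f}, evaluated at z. *)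
definition cauchy_aug_term ::
    "complex \<Rightarrow> complex \<Rightarrow> complex \<Rightarrow> (complex \<Rightarrow> complex) \<Rightarrow> complex \<Rightarrow> nat \<Rightarrow> complex" where
  "cauchy_aug_term q \<beta> y f z k =
     qpoch q \<beta> k / qpoch q q k * (y ^ k * (qderiv q ^^ k) f z)"

definition cauchy_aug_converges ::
    "complex \<Rightarrow> complex \<Rightarrow> complex \<Rightarrow> (complex \<Rightarrow> complex) \<Rightarrow> complex \<Rightarrow> bool" where
  "cauchy_aug_converges q \<beta> y f z \<longleftrightarrow> summable (cauchy_aug_term q \<beta> y f z)"

definition cauchy_aug ::
    "complex \<Rightarrow> complex \<Rightarrow> complex \<Rightarrow> (complex \<Rightarrow> complex) \<Rightarrow> complex \<Rightarrow> complex" where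
  "cauchy_aug q \<beta> y f z = (\<Sum>k. cauchy_aug_term q \<beta> y f z k)"

definition phi01 :: "complex \<Rightarrow> complex \<Rightarrow> complex \<Rightarrow> complex" where
  "phi01 q b w = (\<Sum>n. q ^ (n * (n - 1)) * w ^ n / (qpoch q b n * qpoch q q n))"

definition qLaguerre ::
    "complex \<Rightarrow> complex \<Rightarrow> real \<Rightarrow> nat \<Rightarrow> complex \<Rightarrow> complex \<Rightarrow> complex" where
  "qLaguerre q lq \<alpha> n x y =
     (\<Sum>k\<le>n. qbinom q n k * (qpowr lq (real k ^ 2 + real k * \<alpha>) / qpoch q (qpowr lq (\<alpha> + 1)) k)
              * (- x) ^ k * y ^ (n - k))"

definition hahn :: "complex \<Rightarrow> complex \<Rightarrow> nat \<Rightarrow> complex \<Rightarrow> complex \<Rightarrow> complex" where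
  "hahn q \<beta> n x y = (\<Sum>k\<le>n. qbinom q n k * qpoch q \<beta> k * x ^ k * y ^ (n - k))"

definition Wpoly ::
    "complex \<Rightarrow> nat \<Rightarrow> complex \<Rightarrow> complex \<Rightarrow> complex \<Rightarrow> complex \<Rightarrow> complex" where
  "Wpoly q n a b u v =
     (\<Sum>k\<le>n. qbinom q n k
              * (qpoch q (a * v) k * qpoch q (b * v) k / qpoch q (a * b * u * v) k)
              * u ^ k * v ^ (n - k))"

(* The function inside the braces of T(beta, y; D_{q,z}){...}; the operator acts on z. *)
definition laguerre_kernel ::
    "complex \<Rightarrow> complex \<Rightarrow> real \<Rightarrow> complex \<Rightarrow> complex \<Rightarrow> complex \<Rightarrow> complex \<Rightarrow> complex" where
  "laguerre_kernel q lq \<alpha> a b x z =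
     1 / qpoch_inf q (b * z * x)
       * phi01 q (qpowr lq (\<alpha> + 1)) (- qpowr lq (\<alpha> + 1) * a * z * x)"

end

theory Submission
  imports Defs
begin

text \<open>Write \<open>F n = qLaguerre n / qpoch q q n\<close>. By the \<open>q\<close>-exponential series the kernel is
  \<open>\<Sum>n. F n * (x * z) ^ n\<close>, and the augmentation operator maps \<open>z ^ n\<close> to \<open>hahn n y z\<close>, so the
  integrand becomes \<open>\<Sum>n. F n * hahn n y z * x ^ n\<close> times the weight. The moments of the weight
  follow from its first-order \<open>q\<close>-difference (Pearson) equation: telescoping gives the three-term recurrence
  satisfied by \<open>Wpoly\<close>, and shifting \<open>c\<close> and \<open>d\<close> towards \<open>0\<close> evaluates the total mass.

  If \<open>\<bar>b * y * u\<bar>\<close> or \<open>\<bar>b * y * v\<bar>\<close> is at least \<open>1\<close>, convergence of the operator sum forces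
  \<open>F n\<close> to decay faster than its generic rate \<open>\<bar>b\<bar> ^ n\<close>, unless \<open>\<beta>\<close> is a power of \<open>1 / q\<close> and the sum is finite;
  in all cases the double series is then dominated by a geometric one.\<close>

section \<open>Series\<close>

text \<open>One alternative of the convergence hypothesis puts no explicit bound on
  \<open>y\<close>, and this shapes the analytic part. Three growth rates meet in the double series:
  \<open>\<tau>\<close> for the coefficients \<open>F n\<close>, \<open>M\<close> for the Hahn
  polynomials, and the larger of \<open>norm u\<close> and \<open>norm v\<close> for
  \<open>Wpoly\<close> and the powers of the nodes. All interchanges of limits go through once the
  product of the three is below 1. They are therefore carried out for abstract \<open>\<tau>\<close>
  and \<open>M\<close>, and the convergence hypothesis is converted into such rates separately.

  The weight is never expanded into a series. Its Pearson equation determines every moment from the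
  total mass, and the shifts reduce that mass, up to explicit products, to one common quantity; a
  single weight of known mass is then enough to find it.\<close>

lemma summable_prod_geometric:
  fixes \<rho> \<sigma> :: real
  assumes "0 \<le> \<rho>" "\<rho> < 1" "0 \<le> \<sigma>" "\<sigma> < 1"
  shows "(\<lambda>(k, n). \<rho> ^ k * \<sigma> ^ n) summable_on UNIV \<times> UNIV"
proof (rule summable_on_SigmaI)
  have geo: "((\<lambda>n. x ^ n) has_sum (1 / (1 - x))) UNIV" if "0 \<le> x" "x < 1" for x :: real
    using that by (intro sums_nonneg_imp_has_sum geometric_sums) auto
  show "((\<lambda>n. case (k, n) of (k, n) \<Rightarrow> \<rho> ^ k * \<sigma> ^ n) has_sum \<rho> ^ k * (1 / (1 - \<sigma>))) UNIV" for k
    using has_sum_cmult_right[OF geo] assms by simp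
  have "((\<lambda>k. \<rho> ^ k * (1 / (1 - \<sigma>))) has_sum ((1 / (1 - \<rho>)) * (1 / (1 - \<sigma>)))) UNIV"
    by (intro has_sum_cmult_left geo assms)
  then show "(\<lambda>k. \<rho> ^ k * (1 / (1 - \<sigma>))) summable_on UNIV" by (rule has_sum_imp_summable)
  show "0 \<le> (case (k, n) of (k, n) \<Rightarrow> \<rho> ^ k * \<sigma> ^ n)" for k n
    using assms by simp
qed

text \<open>The geometric majorant makes the family summable over all pairs, so rows and
  antidiagonals give the same total. In the application \<open>k\<close> is the order of the
  q-derivative, \<open>n\<close> the remaining power of \<open>z\<close>, and the antidiagonals
  produce Hahn polynomials.\<close>

lemma double_sum_diagonal:
  fixes a :: "nat \<Rightarrow> nat \<Rightarrow> complex"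
  assumes bound: "\<And>k n. norm (a k n) \<le> C * \<rho> ^ k * \<sigma> ^ n"
    and rows: "\<And>k. a k sums s k"
    and "0 \<le> \<rho>" "\<rho> < 1" "0 \<le> \<sigma>" "\<sigma> < 1"
  shows "summable s" and "(\<lambda>N. \<Sum>k\<le>N. a k (N - k)) sums (\<Sum>k. s k)"
proof -
  have "(\<lambda>p. C * (case p of (k, n) \<Rightarrow> \<rho> ^ k * \<sigma> ^ n)) summable_on UNIV \<times> UNIV"
    using assms by (intro summable_on_cmult_right summable_prod_geometric)
  then have "(\<lambda>p. norm (case p of (k, n) \<Rightarrow> a k n)) summable_on UNIV \<times> UNIV"
    by (rule summable_on_comparison_test) (use bound in \<open>auto simp: mult.assoc\<close>)
  then have sm: "(\<lambda>(k, n). a k n) summable_on UNIV \<times> UNIV"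
    by (rule abs_summable_summable)
  then obtain S where S: "((\<lambda>(k, n). a k n) has_sum S) (UNIV \<times> UNIV)"
    by (auto simp: summable_on_def)
  have row: "(a k has_sum s k) UNIV" for k
  proof -
    have "summable (\<lambda>n. norm (a k n))"
      using summable_comparison_test'[of "\<lambda>n. C * \<rho> ^ k * \<sigma> ^ n" 0 "\<lambda>n. norm (a k n)"] assms
      by (auto intro!: summable_mult summable_geometric)
    then show ?thesis using norm_summable_imp_has_sum rows by blast
  qed
  have "(s has_sum S) UNIV"
    using has_sum_SigmaD[OF S] row by simp
  then have sS: "s sums S" by (rule has_sum_imp_sums)
  then show "summable s" by (simp add: sums_iff)
  have "((\<lambda>(N, k). a k (N - k)) has_sum S) (SIGMA N:UNIV. {..N})"
  proof (subst has_sum_reindex_bij_witness[where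
        j = "\<lambda>(N, k). (k, N - k)" and i = "\<lambda>(k, n). (k + n, k)" and T = "UNIV \<times> UNIV"])
  qed (use S in auto)
  then have "((\<lambda>N. \<Sum>k\<le>N. a k (N - k)) has_sum S) UNIV"
    by (rule has_sum_SigmaD) (auto intro!: has_sum_finiteI)
  then have "(\<lambda>N. \<Sum>k\<le>N. a k (N - k)) sums S" by (rule has_sum_imp_sums)
  then show "(\<lambda>N. \<Sum>k\<le>N. a k (N - k)) sums (\<Sum>k. s k)"
    using sS by (simp add: sums_iff)
qed

text \<open>The coefficients of a function with a pole at \<open>1 / b\<close> are bounded by
  \<open>\<tau> ^ n\<close> only for rates strictly above \<open>norm b\<close>; this provides the
  room.\<close>

lemma ex_greater_mult_less_1:
  fixes B t :: real
  assumes "0 \<le> t" "B * t < 1"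
  shows "\<exists>\<tau>>B. \<tau> * t < 1"
proof (cases "t = 0")
  case True
  then show ?thesis by (auto intro: gt_ex)
next
  case False
  then have "B < 1 / t" using assms by (simp add: field_simps)
  then obtain \<tau> where "B < \<tau>" "\<tau> < 1 / t" using dense by blast
  then show ?thesis using False assms by (auto simp: field_simps)
qed

lemma Suc_mult_power_bounded:
  fixes r :: real
  assumes "0 \<le> r" "r < 1"
  shows "\<exists>K. \<forall>n. real (Suc n) * r ^ n \<le> K"
proof -
  have "(\<lambda>n. real n * r ^ n + r ^ n) \<longlonglongrightarrow> 0 + 0"
    using assms by (intro tendsto_add powser_times_n_limit_0 LIMSEQ_power_zero) auto
  from convergent_imp_Bseq[OF convergentI[OF this]]
  obtain K where "\<And>n. norm (real n * r ^ n + r ^ n) \<le> K" by (auto simp: Bseq_def)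
  then have "real (Suc n) * r ^ n \<le> K" for n
    using abs_ge_self[of "real n * r ^ n + r ^ n"] order_trans by (fastforce simp: algebra_simps)
  then show ?thesis by blast
qed

lemma summable_Suc_square_power:
  fixes r :: real
  assumes "0 \<le> r" "r < 1"
  shows "summable (\<lambda>n. real (Suc n) ^ 2 * r ^ n)"
proof -
  \<comment> \<open>Splitting \<open>r ^ n\<close> into three factors \<open>t ^ n\<close> spends
    two of them on the two linear factors and keeps the third as a geometric majorant.\<close>
  define t where "t = root 3 r"
  have t: "0 \<le> t" "t < 1" "t ^ 3 = r" using assms by (auto simp: t_def real_root_pow_pos2)
  obtain K where K: "\<And>n. real (Suc n) * t ^ n \<le> K" using Suc_mult_power_bounded t by blast
  show ?thesis
  proof (rule summable_comparison_test')
    show "summable (\<lambda>n. K ^ 2 * t ^ n)" using t by (intro summable_mult summable_geometric) simp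
    show "norm (real (Suc n) ^ 2 * r ^ n) \<le> K ^ 2 * t ^ n" for n
    proof -
      have "real (Suc n) ^ 2 * r ^ n = (real (Suc n) * t ^ n) ^ 2 * t ^ n"
        unfolding t(3)[symmetric]
        by (simp add: power_mult_distrib power_mult[symmetric] power_add[symmetric] mult.commute del: of_nat_Suc)
      also have "\<dots> \<le> K ^ 2 * t ^ n"
        using t by (intro mult_right_mono power_mono K) auto
      finally show ?thesis using t assms by simp
    qed
  qed
qed

section \<open>The q-Pochhammer symbol and the q-exponential series\<close>

locale nome =
  fixes q :: complex
  assumes q_nonzero: "q \<noteq> 0" and norm_q_less_1: "norm q < 1"
begin

lemma norm_q_power_le: "norm q ^ n \<le> 1"
  using norm_q_less_1 by (simp add: power_le_one)

lemma q_power_tendsto_0: "(\<lambda>n. a * q ^ n) \<longlonglongrightarrow> 0"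
  using LIMSEQ_power_zero[OF norm_q_less_1] tendsto_mult_right_zero by blast

lemma norm_mult_q_power_le: "norm (a * q ^ n) \<le> norm a"
  using norm_q_power_le[of n] by (simp add: norm_mult norm_power mult_left_le)

lemma mult_q_power_neq_1: "norm a < 1 \<Longrightarrow> a * q ^ n \<noteq> 1"
  using norm_mult_q_power_le[of a n] by auto

lemma qpoch_0 [simp]: "qpoch q a 0 = 1"
  by (simp add: qpoch_def)

lemma qpoch_Suc: "qpoch q a (Suc n) = qpoch q a n * (1 - a * q ^ n)"
  by (simp add: qpoch_def)

lemma qpoch_Suc_shift: "qpoch q a (Suc n) = (1 - a) * qpoch q (a * q) n"
  unfolding qpoch_def by (subst prod.lessThan_Suc_shift) (simp add: mult_ac)

lemma convergent_prod_qpoch: "convergent_prod (\<lambda>i. 1 - a * q ^ i)"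
proof (rule abs_convergent_prod_imp_convergent_prod)
  have "summable (\<lambda>i. norm a * norm q ^ i)"
    using norm_q_less_1 by (intro summable_mult summable_geometric) auto
  then show "abs_convergent_prod (\<lambda>i. 1 - a * q ^ i)"
    by (simp add: abs_convergent_prod_conv_summable norm_mult norm_power)
qed

lemma qpoch_tendsto: "(\<lambda>n. qpoch q a n) \<longlonglongrightarrow> qpoch_inf q a"
proof -
  have "(\<lambda>n. qpoch q a (Suc n)) \<longlonglongrightarrow> qpoch_inf q a"
    using convergent_prod_LIMSEQ[OF convergent_prod_qpoch[of a]]
    by (simp add: qpoch_def qpoch_inf_def lessThan_Suc_atMost)
  then show ?thesis by (rule LIMSEQ_imp_Suc)
qed

lemma qpoch_inf_rec: "qpoch_inf q a = (1 - a) * qpoch_inf q (a * q)"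
proof -
  have "(\<lambda>n. qpoch q a (Suc n)) \<longlonglongrightarrow> (1 - a) * qpoch_inf q (a * q)"
    unfolding qpoch_Suc_shift by (intro tendsto_intros qpoch_tendsto)
  moreover have "(\<lambda>n. qpoch q a (Suc n)) \<longlonglongrightarrow> qpoch_inf q a"
    using qpoch_tendsto by (rule LIMSEQ_Suc)
  ultimately show ?thesis using LIMSEQ_unique by blast
qed

lemma qpoch_inf_split: "qpoch_inf q a = qpoch q a n * qpoch_inf q (a * q ^ n)"
proof (induction n)
  case (Suc n)
  then show ?case using qpoch_inf_rec[of "a * q ^ n"] by (simp add: qpoch_Suc mult_ac)
qed simp

lemma qpoch_eq_0_iff: "qpoch q a n = 0 \<longleftrightarrow> (\<exists>i<n. a * q ^ i = 1)"
  by (auto simp: qpoch_def)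

lemma qpoch_nonzero: "norm a < 1 \<Longrightarrow> qpoch q a n \<noteq> 0"
  using mult_q_power_neq_1 by (auto simp: qpoch_eq_0_iff)

lemma qpoch_inf_nonzero': "(\<And>i. a * q ^ i \<noteq> 1) \<Longrightarrow> qpoch_inf q a \<noteq> 0"
  unfolding qpoch_inf_def by (intro prodinf_nonzero convergent_prod_qpoch) auto

lemma qpoch_inf_nonzero: "norm a < 1 \<Longrightarrow> qpoch_inf q a \<noteq> 0"
  by (intro qpoch_inf_nonzero' mult_q_power_neq_1)

lemma qpoch_bounded: "\<exists>C>0. \<forall>n. norm (qpoch q a n) \<le> C"
  using convergent_imp_Bseq[OF convergentI[OF qpoch_tendsto[of a]]] by (auto simp: Bseq_def)

lemma inverse_qpoch_bounded':
  assumes "\<And>i. a * q ^ i \<noteq> 1"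
  shows "\<exists>C>0. \<forall>n. norm (1 / qpoch q a n) \<le> C"
proof -
  have "(\<lambda>n. 1 / qpoch q a n) \<longlonglongrightarrow> 1 / qpoch_inf q a"
    using assms by (intro tendsto_intros qpoch_tendsto qpoch_inf_nonzero')
  from convergent_imp_Bseq[OF convergentI[OF this]] show ?thesis by (auto simp: Bseq_def)
qed

lemma inverse_qpoch_bounded: "norm a < 1 \<Longrightarrow> \<exists>C>0. \<forall>n. norm (1 / qpoch q a n) \<le> C"
  by (intro inverse_qpoch_bounded' mult_q_power_neq_1)

text \<open>A tail is the infinite product divided by a partial product, provided no factor
  vanishes; a preliminary shift by \<open>q ^ m\<close> into the unit disc ensures that.\<close>

lemma qpoch_inf_tendsto_1: "(\<lambda>n. qpoch_inf q (a * q ^ n)) \<longlonglongrightarrow> 1"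
proof -
  have "eventually (\<lambda>n. norm (a * q ^ n) < 1) sequentially"
    using tendstoD[OF q_power_tendsto_0[of a], of 1] by simp
  then obtain m where m: "norm (a * q ^ m) < 1"
    by (auto simp: eventually_sequentially)
  define b where "b = a * q ^ m"
  have "(\<lambda>n. qpoch_inf q b / qpoch q b n) \<longlonglongrightarrow> qpoch_inf q b / qpoch_inf q b"
    using m by (intro tendsto_intros qpoch_tendsto qpoch_inf_nonzero) (simp add: b_def)
  moreover have "qpoch_inf q b / qpoch q b n = qpoch_inf q (a * q ^ (n + m))" for n
    using qpoch_inf_split[of b n] qpoch_nonzero[of b n] m
    by (simp add: b_def power_add mult_ac)
  moreover have "qpoch_inf q b \<noteq> 0" using m by (intro qpoch_inf_nonzero) (simp add: b_def)
  ultimately have "(\<lambda>n. qpoch_inf q (a * q ^ (n + m))) \<longlonglongrightarrow> 1" by simp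
  then show ?thesis by (rule LIMSEQ_offset)
qed

lemma q_exponential_abs_summable:
  assumes "norm t < 1"
  shows "summable (\<lambda>n. norm (t ^ n / qpoch q q n))"
proof -
  obtain C where C: "\<And>n. norm (1 / qpoch q q n) \<le> C"
    using inverse_qpoch_bounded[OF norm_q_less_1] by blast
  show ?thesis
  proof (rule summable_comparison_test')
    show "summable (\<lambda>n. C * norm t ^ n)" using assms by (intro summable_mult summable_geometric) auto
    show "norm (norm (t ^ n / qpoch q q n)) \<le> C * norm t ^ n" for n
      using mult_right_mono[OF C[of n], of "norm t ^ n"] by (simp add: norm_power norm_divide)
  qed
qed

text \<open>Euler's identity. Comparing coefficients gives \<open>E s * (1 - s) = E (s * q)\<close>;
  iteration drives the argument to 0, where continuity of the power series yields the value
  1.\<close>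

lemma q_exponential_sums:
  assumes "norm t < 1"
  shows "(\<lambda>n. t ^ n / qpoch q q n) sums (1 / qpoch_inf q t)"
proof -
  define E where "E s = (\<Sum>n. 1 / qpoch q q n * s ^ n)" for s
  have E: "(\<lambda>n. 1 / qpoch q q n * s ^ n) sums E s" if "norm s < 1" for s
    using summable_sums[OF summable_norm_cancel[OF q_exponential_abs_summable[OF that]]]
    by (simp add: E_def)
  have step: "E s * (1 - s) = E (s * q)" if s: "norm s < 1" for s
  proof -
    have "norm (s * q) < 1"
      using norm_mult_q_power_le[of s 1] s by simp
    then have "(\<lambda>n. 1 / qpoch q q n * s ^ n - 1 / qpoch q q n * (s * q) ^ n) sums (E s - E (s * q))"
      using s by (intro sums_diff E)
    then have "(\<lambda>n. 1 / qpoch q q (Suc n) * s ^ Suc n - 1 / qpoch q q (Suc n) * (s * q) ^ Suc n)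
                 sums (E s - E (s * q))"
      by (subst sums_Suc_iff) simp
    moreover have "1 / qpoch q q (Suc n) * s ^ Suc n - 1 / qpoch q q (Suc n) * (s * q) ^ Suc n
        = s * (1 / qpoch q q n * s ^ n)" for n
    proof -
      have "1 - q * q ^ n \<noteq> 0"
        using mult_q_power_neq_1[OF norm_q_less_1, of n] by auto
      then show ?thesis
        using qpoch_nonzero[OF norm_q_less_1, of n]
        by (simp add: qpoch_Suc power_mult_distrib divide_simps) (simp add: algebra_simps)
    qed
    ultimately have "(\<lambda>n. s * (1 / qpoch q q n * s ^ n)) sums (E s - E (s * q))" by simp
    moreover have "(\<lambda>n. s * (1 / qpoch q q n * s ^ n)) sums (s * E s)"
      using s by (intro sums_mult E)
    ultimately have "s * E s = E s - E (s * q)" using sums_unique2 by blast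
    then show ?thesis by (simp add: algebra_simps)
  qed
  have iter: "qpoch q t n * E t = E (t * q ^ n)" for n
  proof (induction n)
    case (Suc n)
    have "norm (t * q ^ n) < 1" using norm_mult_q_power_le[of t n] assms by simp
    from step[OF this] have "E (t * q ^ Suc n) = E (t * q ^ n) * (1 - t * q ^ n)"
      by (simp add: mult_ac)
    then show ?case unfolding Suc[symmetric] by (simp add: qpoch_Suc mult_ac)
  qed simp
  have "isCont E 0"
    unfolding E_def
    by (rule isCont_powser[where K = "1/2"])
       (use E[of "1/2"] in \<open>auto simp: sums_iff\<close>)
  then have "(\<lambda>n. E (t * q ^ n)) \<longlonglongrightarrow> E 0"
    using isCont_tendsto_compose q_power_tendsto_0 by blast
  moreover have "E 0 = 1" unfolding E_def powser_zero by simp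
  moreover have "(\<lambda>n. qpoch q t n * E t) \<longlonglongrightarrow> qpoch_inf q t * E t"
    by (intro tendsto_intros qpoch_tendsto)
  ultimately have "qpoch_inf q t * E t = 1"
    using LIMSEQ_unique unfolding iter by metis
  then have "E t = 1 / qpoch_inf q t" 
    using qpoch_inf_nonzero[OF assms] by (simp add: field_simps)
  with E[OF assms] show ?thesis by simp
qed

end

section \<open>Iterated q-derivatives of power series\<close>

context nome
begin

text \<open>Away from 0 this is termwise subtraction. At 0 the quotient agrees nearby with a power
  series, so the limit that defines \<open>qderiv\<close> there is its constant term.\<close>

lemma qderiv_powser:
  fixes c :: "nat \<Rightarrow> complex" and B :: complex
  assumes sums_f: "\<And>w. norm (B * w) < 1 \<Longrightarrow> (\<lambda>n. c n * w ^ n) sums f w"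
    and "norm (B * w) < 1"
  shows "(\<lambda>n. (1 - q ^ Suc n) * c (Suc n) * w ^ n) sums qderiv q f w"
proof -
  define U where "U = {w. norm (B * w) < 1}"
  have f: "(\<lambda>n. c n * x ^ n) sums f x" if "x \<in> U" for x
    using that sums_f by (simp add: U_def)
  have w: "w \<in> U" using assms by (simp add: U_def)
  have qU: "q * x \<in> U" if "x \<in> U" for x
    using that norm_mult_q_power_le[of "B * x" 1] by (simp add: U_def mult_ac)
  have diff: "(\<lambda>n. (1 - q ^ Suc n) * c (Suc n) * x ^ n) sums ((f x - f (q * x)) / x)"
    if x: "x \<in> U" "x \<noteq> 0" for x
  proof -
    have "(\<lambda>n. c n * x ^ n - c n * (q * x) ^ n) sums (f x - f (q * x))"
      using x by (intro sums_diff f qU)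
    then have "(\<lambda>n. c (Suc n) * x ^ Suc n - c (Suc n) * (q * x) ^ Suc n) sums (f x - f (q * x))"
      by (subst sums_Suc_iff) simp
    then have "(\<lambda>n. (c (Suc n) * x ^ Suc n - c (Suc n) * (q * x) ^ Suc n) / x)
                 sums ((f x - f (q * x)) / x)"
      by (rule sums_divide)
    moreover have "(c (Suc n) * x ^ Suc n - c (Suc n) * (q * x) ^ Suc n) / x
        = (1 - q ^ Suc n) * c (Suc n) * x ^ n" for n
      using x(2) by (simp add: power_mult_distrib field_simps)
    ultimately show ?thesis by simp
  qed
  show ?thesis
  proof (cases "w = 0")
    case False
    then show ?thesis using diff[OF w] by (simp add: qderiv_def)
  next
    case True
    \<comment> \<open>A nonzero point of the disc witnesses a positive radius of convergence; for
      \<open>B = 0\<close> the disc is the whole plane.\<close>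
    define K where "K = (if B = 0 then 1 else 1 / (2 * B))"
    have K: "K \<in> U" "K \<noteq> 0" by (auto simp: K_def U_def norm_mult norm_divide)
    define g where "g x = (\<Sum>n. (1 - q ^ Suc n) * c (Suc n) * x ^ n)" for x
    have "isCont g 0"
      unfolding g_def
      using diff[OF K] K by (intro isCont_powser[where K = K]) (auto simp: sums_iff)
    then have lim: "(g \<longlongrightarrow> g 0) (at 0)" by (simp add: isCont_def)
    have "open U" unfolding U_def by (intro open_Collect_less continuous_intros)
    moreover have "0 \<in> U" by (simp add: U_def)
    ultimately have "eventually (\<lambda>x. x \<in> U - {0}) (at 0)"
      by (rule eventually_at_in_open)
    then have ev: "eventually (\<lambda>x. (f x - f (q * x)) / x = g x) (at 0)"
      unfolding g_def by eventually_elim (intro sums_unique diff, auto)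
    have "((\<lambda>x. (f x - f (q * x)) / x) \<longlongrightarrow> g 0) (at 0)"
      using lim tendsto_cong[OF ev] by blast
    then have "Lim (at 0) (\<lambda>x. (f x - f (q * x)) / x) = g 0"
      by (intro tendsto_Lim) auto
    then show ?thesis
      using powser_sums_zero[of "\<lambda>n. (1 - q ^ Suc n) * c (Suc n)"]
      unfolding True g_def powser_zero by (simp add: qderiv_def)
  qed
qed

lemma qderiv_funpow_powser:
  assumes f: "\<And>w. norm (B * w) < 1 \<Longrightarrow> (\<lambda>n. c n * w ^ n) sums f w"
    and w: "norm (B * w) < 1"
  shows "(\<lambda>n. qpoch q q (n + k) / qpoch q q n * c (n + k) * w ^ n) sums (qderiv q ^^ k) f w"
  using w
proof (induction k arbitrary: w)
  case 0
  then show ?case using f qpoch_nonzero[OF norm_q_less_1] by simp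
next
  case (Suc k)
  have "(1 - q ^ Suc n) * (qpoch q q (Suc n + k) / qpoch q q (Suc n) * c (Suc n + k))
      = qpoch q q (n + Suc k) / qpoch q q n * c (n + Suc k)" for n
  proof -
    have "1 - q ^ Suc n \<noteq> 0"
      using mult_q_power_neq_1[OF norm_q_less_1, of n] by auto
    then show ?thesis by (simp add: qpoch_Suc[of q n])
  qed
  with qderiv_powser[OF Suc.IH Suc.prems] show ?case
    by (simp only: funpow.simps o_apply)
qed

end

section \<open>Jackson sums and the Pearson equation\<close>

context nome
begin

text \<open>The bound is uniform in \<open>n\<close> and increasing in \<open>norm a\<close>, so one
  constant dominates the partial products at all nodes; this is what the passage to the limit under
  the Jackson sum requires.\<close>

lemma norm_qpoch_le: "norm (qpoch q a n) \<le> exp (norm a / (1 - norm q))"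
proof -
  have "norm (qpoch q a n) \<le> (\<Prod>i<n. exp (norm a * norm q ^ i))"
    unfolding qpoch_def prod_norm[symmetric]
  proof (intro prod_mono conjI)
    fix i
    have "norm (1 - a * q ^ i) \<le> 1 + norm a * norm q ^ i"
      using norm_triangle_ineq4[of 1 "a * q ^ i"] by (simp add: norm_mult norm_power)
    also have "\<dots> \<le> exp (norm a * norm q ^ i)" by (rule exp_ge_add_one_self)
    finally show "norm (1 - a * q ^ i) \<le> exp (norm a * norm q ^ i)" .
  qed simp
  also have "\<dots> = exp (norm a * (\<Sum>i<n. norm q ^ i))"
    by (simp add: exp_sum sum_distrib_left)
  also have "(\<Sum>i<n. norm q ^ i) \<le> 1 / (1 - norm q)"
    using sum_le_suminf[of "\<lambda>i. norm q ^ i" "{..<n}"] norm_q_less_1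
    by (simp add: suminf_geometric summable_geometric)
  then have "exp (norm a * (\<Sum>i<n. norm q ^ i)) \<le> exp (norm a / (1 - norm q))"
    using mult_left_mono[of "\<Sum>i<n. norm q ^ i" "1 / (1 - norm q)" "norm a"] by simp
  finally show ?thesis .
qed

text \<open>The factor \<open>q ^ n\<close> in a Jackson term makes boundedness on the nodes
  sufficient for convergence, and the property is stable under products.\<close>

definition bounded_on_nodes :: "complex \<Rightarrow> complex \<Rightarrow> (complex \<Rightarrow> complex) \<Rightarrow> bool" where
  "bounded_on_nodes u v f \<longleftrightarrow> (\<exists>M. \<forall>x\<in>jackson_nodes q u v. norm (f x) \<le> M)"

lemma bounded_on_nodesI:
  "(\<And>x. x \<in> jackson_nodes q u v \<Longrightarrow> norm (f x) \<le> M) \<Longrightarrow> bounded_on_nodes u v f"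
  by (auto simp: bounded_on_nodes_def)

lemma node_cases [consumes 1]:
  assumes "x \<in> jackson_nodes q u v"
  obtains n where "x = u * q ^ n" | n where "x = v * q ^ n"
  using assms by (auto simp: jackson_nodes_def)

lemma nodes_memI [simp, intro]:
  "u * q ^ n \<in> jackson_nodes q u v" "v * q ^ n \<in> jackson_nodes q u v"
  by (auto simp: jackson_nodes_def)

lemma norm_mult_node_le:
  "x \<in> jackson_nodes q u v \<Longrightarrow> norm (c * x) \<le> max (norm (c * u)) (norm (c * v))"
  using norm_mult_q_power_le[of "c * u"] norm_mult_q_power_le[of "c * v"]
  by (elim node_cases) (simp_all add: mult.assoc[symmetric] le_max_iff_disj)

lemma bounded_on_nodes_mult:
  assumes "bounded_on_nodes u v f" "bounded_on_nodes u v g"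
  shows "bounded_on_nodes u v (\<lambda>x. f x * g x)"
proof -
  from assms obtain M N where M: "\<forall>x\<in>jackson_nodes q u v. norm (f x) \<le> M"
    and N: "\<forall>x\<in>jackson_nodes q u v. norm (g x) \<le> N"
    by (auto simp: bounded_on_nodes_def)
  show ?thesis
  proof (rule bounded_on_nodesI)
    fix x assume "x \<in> jackson_nodes q u v"
    with M N have "norm (f x) * norm (g x) \<le> M * N"
      by (intro mult_mono) (auto intro: order_trans[OF norm_ge_zero])
    then show "norm (f x * g x) \<le> M * N" by (simp add: norm_mult)
  qed
qed

lemma bounded_on_nodes_power: "bounded_on_nodes u v (\<lambda>x. x ^ n)"
  using norm_mult_node_le[of _ u v 1]
  by (intro bounded_on_nodesI[where M = "max (norm u) (norm v) ^ n"])
     (auto simp: norm_power intro!: power_mono)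

lemma bounded_on_nodes_LIMSEQ:
  assumes "(\<lambda>n. f (u * q ^ n)) \<longlonglongrightarrow> l" "(\<lambda>n. f (v * q ^ n)) \<longlonglongrightarrow> l'"
  shows "bounded_on_nodes u v f"
proof -
  from assms obtain M N where "\<forall>n. norm (f (u * q ^ n)) \<le> M" "\<forall>n. norm (f (v * q ^ n)) \<le> N"
    by (metis convergentI convergent_imp_Bseq Bseq_def)
  then show ?thesis
    by (intro bounded_on_nodesI[where M = "max M N"]) (auto elim!: node_cases simp: le_max_iff_disj)
qed

lemma norm_jackson_term_le:
  assumes "\<And>x. x \<in> jackson_nodes q u v \<Longrightarrow> norm (f x) \<le> M"
  shows "norm (jackson_term q u v f n) \<le> (norm u + norm v) * M * norm q ^ n"
proof -
  have "norm (v * f (v * q ^ n) - u * f (u * q ^ n)) \<le> norm u * M + norm v * M"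
    unfolding add.commute[of "norm u * M"]
    by (rule order_trans[OF norm_triangle_ineq4])
       (unfold norm_mult, intro add_mono mult_left_mono assms, auto)
  then show ?thesis
    unfolding jackson_term_def norm_mult norm_power distrib_right[of "norm u"]
    by (rule mult_right_mono) simp
qed

lemma summable_jackson_term:
  assumes "bounded_on_nodes u v f"
  shows "summable (jackson_term q u v f)"
proof -
  from assms obtain M where M: "\<And>x. x \<in> jackson_nodes q u v \<Longrightarrow> norm (f x) \<le> M"
    by (auto simp: bounded_on_nodes_def)
  have "summable (\<lambda>n. (norm u + norm v) * M * norm q ^ n)"
    using norm_q_less_1 by (intro summable_mult summable_geometric) simp
  then show ?thesis
    by (rule summable_comparison_test') (rule norm_jackson_term_le[OF M])
qed

abbreviation jackson_sum :: "complex \<Rightarrow> complex \<Rightarrow> (complex \<Rightarrow> complex) \<Rightarrow> complex" where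
  "jackson_sum u v f \<equiv> (\<Sum>n. jackson_term q u v f n)"

lemma jackson_term_cong:
  "(\<And>x. x \<in> jackson_nodes q u v \<Longrightarrow> f x = g x) \<Longrightarrow> jackson_term q u v f = jackson_term q u v g"
  by (auto simp: jackson_term_def)

text \<open>The Pearson equation of a weight: in terms of
  \<open>g x = (u - x) * (v - x) * w x\<close>, which vanishes at the endpoints, it says
  \<open>g (q * x) = u * v * (1 - c * x) * (1 - d * x) * w x\<close>, so that telescoping \<open>g x - g (q * x)\<close>
  yields relations between the moments of \<open>w\<close>.\<close>

definition pearson :: "complex \<Rightarrow> complex \<Rightarrow> complex \<Rightarrow> complex \<Rightarrow> (complex \<Rightarrow> complex) \<Rightarrow> bool" where
  "pearson u v c d w \<longleftrightarrow>
     (\<lambda>n. w (u * q ^ n)) \<longlonglongrightarrow> 1 \<and> (\<lambda>n. w (v * q ^ n)) \<longlonglongrightarrow> 1 \<and>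
     (\<forall>x\<in>jackson_nodes q u v.
        (u - q * x) * (v - q * x) * w (q * x) = u * v * (1 - c * x) * (1 - d * x) * w x)"

lemma pearson_commute: "pearson u v c d w \<longleftrightarrow> pearson u v d c w"
  by (auto simp: pearson_def mult_ac)

lemma pearson_bounded: "pearson u v c d w \<Longrightarrow> bounded_on_nodes u v w"
  by (auto simp: pearson_def intro: bounded_on_nodes_LIMSEQ)

text \<open>At \<open>q * x\<close> the new factor is \<open>1 - c * q * x\<close>, which is exactly
  the linear factor that the shifted equation asks for, while the old \<open>1 - c * x\<close> is
  absorbed into the weight.\<close>

lemma pearson_shift:
  assumes "pearson u v c d w"
  shows "pearson u v (c * q) d (\<lambda>x. w x * (1 - c * x))"
  unfolding pearson_def
proof (intro conjI ballI)
  have "(\<lambda>n. 1 - c * (s * q ^ n)) \<longlonglongrightarrow> 1 - 0" for s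
    using q_power_tendsto_0[of "c * s"] by (intro tendsto_diff tendsto_const) (simp add: mult.assoc)
  then have *: "(\<lambda>n. 1 - c * (s * q ^ n)) \<longlonglongrightarrow> 1" for s by simp
  show "(\<lambda>n. w (u * q ^ n) * (1 - c * (u * q ^ n))) \<longlonglongrightarrow> 1"
       "(\<lambda>n. w (v * q ^ n) * (1 - c * (v * q ^ n))) \<longlonglongrightarrow> 1"
    using assms tendsto_mult[OF _ *] unfolding pearson_def by fastforce+
next
  fix x assume "x \<in> jackson_nodes q u v"
  with assms have "(u - q * x) * (v - q * x) * w (q * x) = u * v * (1 - c * x) * (1 - d * x) * w x"
    by (simp add: pearson_def)
  then have "(u - q * x) * (v - q * x) * w (q * x) * (1 - c * (q * x))
       = u * v * (1 - c * x) * (1 - d * x) * w x * (1 - c * (q * x))" by simp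
  then show "(u - q * x) * (v - q * x) * (w (q * x) * (1 - c * (q * x))) =
       u * v * (1 - c * q * x) * (1 - d * x) * (w x * (1 - c * x))"
    by (simp add: mult_ac)
qed

lemma pearson_moment_recurrence:
  assumes "pearson u v c d w"
  defines "m \<equiv> \<lambda>N. jackson_sum u v (\<lambda>x. w x * x ^ N)"
  shows "(1 - q ^ N * (c * d * u * v)) * m (Suc N)
    = (u + v - q ^ N * (u * v * (c + d))) * m N - u * v * (1 - q ^ N) * m (N - 1)"
proof -
  define g where "g x = (u - x) * (v - x) * w x * x ^ N" for x
  have lim: "(\<lambda>n. g (s * q ^ n)) \<longlonglongrightarrow> u * v * 0 ^ N" if "(\<lambda>n. w (s * q ^ n)) \<longlonglongrightarrow> 1" for s
    unfolding g_def
    by (rule tendsto_eq_intros q_power_tendsto_0 that refl)+ simp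
  \<comment> \<open>\<open>g\<close> vanishes at \<open>u\<close> and \<open>v\<close>, and its
    limit towards 0, which is nonzero only for \<open>N = 0\<close>, is the same along both
    branches; the total is therefore 0.\<close>
  have tel: "(\<lambda>n. (g (v * q ^ n) - g (v * q ^ Suc n)) - (g (u * q ^ n) - g (u * q ^ Suc n))) sums
      ((g (v * q ^ 0) - u * v * 0 ^ N) - (g (u * q ^ 0) - u * v * 0 ^ N))"
    using assms(1) by (intro sums_diff telescope_sums' lim) (auto simp: pearson_def)
  have key: "g x - g (q * x) = x *
      ((1 - q ^ N * (c * d * u * v)) * (w x * x ^ Suc N)
       - (u + v - q ^ N * (u * v * (c + d))) * (w x * x ^ N)
       + u * v * (1 - q ^ N) * (w x * x ^ (N - 1)))" if "x \<in> jackson_nodes q u v" for x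
  proof -
    have "g (q * x) = ((u - q * x) * (v - q * x) * w (q * x)) * (q ^ N * x ^ N)"
      by (simp add: g_def power_mult_distrib)
    also have "(u - q * x) * (v - q * x) * w (q * x) = u * v * (1 - c * x) * (1 - d * x) * w x"
      using assms(1) that by (simp add: pearson_def)
    finally have gq: "g (q * x) = u * v * (1 - c * x) * (1 - d * x) * w x * (q ^ N * x ^ N)" .
    \<comment> \<open>The truncated exponent \<open>N - 1\<close> does no harm at
      \<open>N = 0\<close>, since the factor \<open>1 - q ^ N\<close> vanishes there.\<close>
    have xN: "(1 - q ^ N) * (x * x ^ (N - 1)) = (1 - q ^ N) * x ^ N"
      by (cases N) auto
    have "x * (u * v * (1 - q ^ N) * (w x * x ^ (N - 1))) = u * v * w x * ((1 - q ^ N) * (x * x ^ (N - 1)))"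
      by (simp add: mult_ac)
    also note xN
    finally show ?thesis unfolding gq unfolding g_def distrib_left[of x]
      by (simp add: algebra_simps)
  qed
  have sums_m: "jackson_term q u v (\<lambda>x. w x * x ^ k) sums m k" for k
    unfolding m_def
    by (intro summable_sums summable_jackson_term bounded_on_nodes_mult bounded_on_nodes_power
          pearson_bounded[OF assms(1)])
  have "(\<lambda>n. (1 - q ^ N * (c * d * u * v)) * jackson_term q u v (\<lambda>x. w x * x ^ Suc N) n
       - (u + v - q ^ N * (u * v * (c + d))) * jackson_term q u v (\<lambda>x. w x * x ^ N) n
       + u * v * (1 - q ^ N) * jackson_term q u v (\<lambda>x. w x * x ^ (N - 1)) n) sums
     ((1 - q ^ N * (c * d * u * v)) * m (Suc N)
       - (u + v - q ^ N * (u * v * (c + d))) * m N + u * v * (1 - q ^ N) * m (N - 1))"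
    by (intro sums_add sums_diff sums_mult sums_m)
  moreover have "(1 - q ^ N * (c * d * u * v)) * jackson_term q u v (\<lambda>x. w x * x ^ Suc N) n
       - (u + v - q ^ N * (u * v * (c + d))) * jackson_term q u v (\<lambda>x. w x * x ^ N) n
       + u * v * (1 - q ^ N) * jackson_term q u v (\<lambda>x. w x * x ^ (N - 1)) n
     = (g (v * q ^ n) - g (v * q ^ Suc n)) - (g (u * q ^ n) - g (u * q ^ Suc n))" for n
  proof -
    have qn: "s * q ^ Suc n = q * (s * q ^ n)" for s by simp
    show ?thesis
      unfolding qn key[OF nodes_memI(1)] key[OF nodes_memI(2)] jackson_term_def
      by (simp add: algebra_simps)
  qed
  ultimately have "(\<lambda>n. (g (v * q ^ n) - g (v * q ^ Suc n)) - (g (u * q ^ n) - g (u * q ^ Suc n))) sums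
     ((1 - q ^ N * (c * d * u * v)) * m (Suc N)
       - (u + v - q ^ N * (u * v * (c + d))) * m N + u * v * (1 - q ^ N) * m (N - 1))"
    by simp
  from sums_unique2[OF this tel] show ?thesis
    by (simp add: g_def algebra_simps)
qed

text \<open>The recurrence at \<open>N = 0\<close> expresses the first moment through the total
  mass. Inserting it works because
  \<open>(1 - c * d * u * v) - c * (u + v - u * v * (c + d))\<close> factors as
  \<open>(1 - c * u) * (1 - c * v)\<close>.\<close>

lemma pearson_shift_sum:
  assumes "pearson u v c d w"
  shows "(1 - c * u) * (1 - c * v) * jackson_sum u v w
    = (1 - c * d * u * v) * jackson_sum u v (\<lambda>x. w x * (1 - c * x))"
proof -
  have b: "bounded_on_nodes u v w" using assms by (rule pearson_bounded)
  have "(\<lambda>n. jackson_term q u v w n - c * jackson_term q u v (\<lambda>x. w x * x ^ 1) n) sums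
      (jackson_sum u v w - c * jackson_sum u v (\<lambda>x. w x * x ^ 1))"
    by (intro sums_diff sums_mult summable_sums summable_jackson_term b bounded_on_nodes_mult
          bounded_on_nodes_power)
  moreover have "jackson_term q u v w n - c * jackson_term q u v (\<lambda>x. w x * x ^ 1) n
      = jackson_term q u v (\<lambda>x. w x * (1 - c * x)) n" for n
    by (simp add: jackson_term_def algebra_simps)
  ultimately have eq: "jackson_sum u v (\<lambda>x. w x * (1 - c * x))
      = jackson_sum u v w - c * jackson_sum u v (\<lambda>x. w x * x ^ 1)"
    by (simp add: sums_iff)
  from pearson_moment_recurrence[OF assms, of 0]
  have "(1 - c * d * u * v) * jackson_sum u v (\<lambda>x. w x * x ^ 1)
      = (u + v - u * v * (c + d)) * jackson_sum u v w" by simp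
  then have "c * ((1 - c * d * u * v) * jackson_sum u v (\<lambda>x. w x * x ^ 1))
      = c * ((u + v - u * v * (c + d)) * jackson_sum u v w)" by simp
  moreover have "(1 - c * u) * (1 - c * v) * X = (1 - c * d * u * v) * (X - c * Y)"
    if "c * ((1 - c * d * u * v) * Y) = c * ((u + v - u * v * (c + d)) * X)" for X Y
    using that by (simp add: algebra_simps)
  ultimately show ?thesis unfolding eq by blast
qed

text \<open>Each round shifts \<open>c\<close> and then, after swapping the roles, \<open>d\<close>.
  Both shifts multiply \<open>c * d\<close> by \<open>q\<close>, hence the index
  \<open>2 * n\<close>.\<close>

lemma pearson_iterate:
  assumes "pearson u v c d w"
  defines "w' \<equiv> \<lambda>n x. w x * (qpoch q (c * x) n * qpoch q (d * x) n)"
  shows "pearson u v (c * q ^ n) (d * q ^ n) (w' n)"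
    and "qpoch q (c * u) n * qpoch q (c * v) n * qpoch q (d * u) n * qpoch q (d * v) n * jackson_sum u v w
      = qpoch q (c * d * u * v) (2 * n) * jackson_sum u v (w' n)"
proof (induction n)
  case 0
  { case 1 show ?case using assms by simp }
  { case 2 show ?case using assms by simp }
next
  case (Suc n)
  note p = Suc(1)
  define w1 where "w1 x = w' n x * (1 - c * q ^ n * x)" for x
  have p1: "pearson u v (d * q ^ n) (c * q ^ Suc n) w1"
    using pearson_shift[OF p] pearson_commute unfolding w1_def by (simp add: mult_ac)
  have w'_Suc: "w' (Suc n) = (\<lambda>x. w1 x * (1 - d * q ^ n * x))"
    by (auto simp: w'_def w1_def qpoch_Suc mult_ac)
  {
    case 1
    show ?case
      using pearson_shift[OF p1] pearson_commute unfolding w'_Suc by (simp add: mult_ac)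
  next
    case 2
    have swap: "s * q ^ n * t = s * t * q ^ n" for s t by simp
    have "(1 - c * u * q ^ n) * (1 - c * v * q ^ n) * jackson_sum u v (w' n)
        = (1 - (c * q ^ n) * (d * q ^ n) * u * v) * jackson_sum u v w1"
      using pearson_shift_sum[OF p] unfolding w1_def swap[of c] .
    moreover have "(1 - d * u * q ^ n) * (1 - d * v * q ^ n) * jackson_sum u v w1
        = (1 - (d * q ^ n) * (c * q ^ Suc n) * u * v) * jackson_sum u v (w' (Suc n))"
      using pearson_shift_sum[OF p1] unfolding w'_Suc swap[of d u] swap[of d v] .
    moreover have eq: "qpoch q (c * d * u * v) (2 * Suc n) = qpoch q (c * d * u * v) (2 * n)
        * (1 - (c * q ^ n) * (d * q ^ n) * u * v) * (1 - (d * q ^ n) * (c * q ^ Suc n) * u * v)"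
      by (simp add: qpoch_Suc power_add[symmetric] mult_2[symmetric] mult_ac)
    moreover have "A * a * (B * b) * (C * g) * (D * h) * S = Q * k * l * S''"
      if "a * b * S' = k * T" "g * h * T = l * S''" "A * B * C * D * S = Q * S'"
      for A B C D Q S S' S'' T a b g h k l :: complex
    proof -
      have "A * a * (B * b) * (C * g) * (D * h) * S = (A * B * C * D * S) * (a * b) * (g * h)"
        by (simp add: mult_ac)
      also have "\<dots> = Q * (a * b * S') * (g * h)" unfolding that(3) by (simp add: mult_ac)
      also have "\<dots> = Q * k * (g * h * T)" unfolding that(1) by (simp add: mult_ac)
      also have "\<dots> = Q * k * l * S''" unfolding that(2) by (simp add: mult_ac)
      finally show ?thesis .
    qed
    moreover note Suc(2)
    ultimately show ?case unfolding eq unfolding qpoch_Suc[of _ n] by blast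
  }
qed

text \<open>Limit of the iterated shift by Tannery's theorem. The products stay as multipliers
  instead of divisors, so that the identity also covers parameters such as \<open>c = q / u\<close>,
  where \<open>norm (c * v)\<close> may be large.\<close>

lemma pearson_limit:
  assumes "pearson u v c d w"
  shows "qpoch_inf q (c * u) * qpoch_inf q (c * v) * qpoch_inf q (d * u) * qpoch_inf q (d * v)
        * jackson_sum u v w
      = qpoch_inf q (c * d * u * v)
        * jackson_sum u v (\<lambda>x. w x * (qpoch_inf q (c * x) * qpoch_inf q (d * x)))"
proof -
  define f where "f n x = w x * (qpoch q (c * x) n * qpoch q (d * x) n)" for n x
  obtain M where M: "\<And>x. x \<in> jackson_nodes q u v \<Longrightarrow> norm (w x) \<le> M"
    using pearson_bounded[OF assms] by (auto simp: bounded_on_nodes_def)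
  define A where "A c = exp (max (norm (c * u)) (norm (c * v)) / (1 - norm q))" for c
  have A: "norm (qpoch q (c * x) n) \<le> A c" if "x \<in> jackson_nodes q u v" for c x n
    using norm_mult_node_le[OF that, of c] norm_q_less_1
    by (intro order_trans[OF norm_qpoch_le]) (auto simp: A_def intro!: divide_right_mono)
  have f_bound: "norm (f n x) \<le> M * (A c * A d)" if "x \<in> jackson_nodes q u v" for n x
    unfolding f_def norm_mult using that
    by (intro mult_mono M A) (auto intro: order_trans[OF norm_ge_zero M] simp: A_def)
  have "(\<lambda>n. jackson_sum u v (f n)) \<longlonglongrightarrow>
      jackson_sum u v (\<lambda>x. w x * (qpoch_inf q (c * x) * qpoch_inf q (d * x)))"
  proof (rule tannerys_theorem[where M = "\<lambda>m. (norm u + norm v) * (M * (A c * A d)) * norm q ^ m", THEN conjunct2, THEN conjunct2])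
    show "(\<lambda>n. jackson_term q u v (f n) m) \<longlonglongrightarrow>
        jackson_term q u v (\<lambda>x. w x * (qpoch_inf q (c * x) * qpoch_inf q (d * x))) m" for m
      unfolding jackson_term_def f_def by (intro tendsto_intros qpoch_tendsto)
    show "\<forall>\<^sub>F (m, n) in sequentially \<times>\<^sub>F sequentially.
        norm (jackson_term q u v (f n) m) \<le> (norm u + norm v) * (M * (A c * A d)) * norm q ^ m"
      using norm_jackson_term_le[OF f_bound] by (intro always_eventually) auto
    show "summable (\<lambda>m. (norm u + norm v) * (M * (A c * A d)) * norm q ^ m)"
      using norm_q_less_1 by (intro summable_mult summable_geometric) simp
  qed simp
  then have "(\<lambda>n. qpoch q (c * d * u * v) (2 * n) * jackson_sum u v (f n)) \<longlonglongrightarrow>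
      qpoch_inf q (c * d * u * v)
        * jackson_sum u v (\<lambda>x. w x * (qpoch_inf q (c * x) * qpoch_inf q (d * x)))"
    by (intro tendsto_mult filterlim_compose[OF qpoch_tendsto] mult_nat_left_at_top) auto
  moreover have "(\<lambda>n. qpoch q (c * u) n * qpoch q (c * v) n * qpoch q (d * u) n * qpoch q (d * v) n
      * jackson_sum u v w) \<longlonglongrightarrow>
      qpoch_inf q (c * u) * qpoch_inf q (c * v) * qpoch_inf q (d * u) * qpoch_inf q (d * v)
        * jackson_sum u v w"
    by (intro tendsto_intros qpoch_tendsto)
  ultimately show ?thesis
    using LIMSEQ_unique unfolding f_def pearson_iterate(2)[OF assms, symmetric] by blast
qed

end

section \<open>Moments of the weight\<close>

context nome
begin

lemma Wpoly_eq:
  "Wpoly q N c d u v = qpoch q q N * (\<Sum>k\<le>N.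
     (qpoch q (c * v) k * qpoch q (d * v) k / (qpoch q (c * d * u * v) k * qpoch q q k) * u ^ k)
       * (v ^ (N - k) / qpoch q q (N - k)))"
  unfolding Wpoly_def qbinom_def sum_distrib_left by (intro sum.cong refl) (simp add: mult_ac)

text \<open>Divided by \<open>qpoch q q N\<close>, the polynomial is the convolution of
  \<open>G\<close> and \<open>p\<close>, each of which obeys a first-order recurrence. The
  coefficients are split so that every piece lowers the index of one of the two factors.\<close>

lemma Wpoly_recurrence:
  assumes "norm (c * d * u * v) < 1"
  shows "(1 - q ^ N * (c * d * u * v)) * Wpoly q (Suc N) c d u v
    = (u + v - q ^ N * (u * v * (c + d))) * Wpoly q N c d u v
      - u * v * (1 - q ^ N) * Wpoly q (N - 1) c d u v"
proof -
  define e where "e = c * d * u * v"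
  define G where
    "G k = qpoch q (c * v) k * qpoch q (d * v) k / (qpoch q e k * qpoch q q k) * u ^ k" for k
  define p where "p j = v ^ j / qpoch q q j" for j
  define P where "P n = (\<Sum>k\<le>n. G k * p (n - k))" for n
  have W: "Wpoly q n c d u v = qpoch q q n * P n" for n
    unfolding Wpoly_eq P_def G_def p_def e_def ..
  have q1: "1 - q * q ^ k \<noteq> 0" and e1: "1 - e * q ^ k \<noteq> 0" for k
    using mult_q_power_neq_1[OF norm_q_less_1] mult_q_power_neq_1[OF assms] by (auto simp: e_def)
  have nz: "qpoch q q k \<noteq> 0" "qpoch q e k \<noteq> 0" for k
    using qpoch_nonzero[OF norm_q_less_1] qpoch_nonzero[OF assms] by (auto simp: e_def)
  define p' where "p' j = (1 - q ^ j) * p j" for j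
  have p'_0: "p' 0 = 0" by (simp add: p'_def)
  have p'_Suc: "p' (Suc j) = v * p j" for j
    using q1[of j] nz by (simp add: p'_def p_def qpoch_Suc field_simps)
  \<comment> \<open>For \<open>k > 0\<close> this makes \<open>1 - q ^ k - \<kappa> k\<close> equal
    to \<open>(1 - q ^ k) * (1 - e * q ^ (k - 1))\<close>, the last factors in the denominator of
    \<open>G k\<close>; at \<open>k = 0\<close> it is 0. So \<open>X (Suc k)\<close> is a multiple
    of \<open>G k\<close>.\<close>
  define \<kappa> where "\<kappa> k = e * q ^ (k - 1) * (1 - q ^ k)" for k
  have \<kappa>: "q ^ (n - k) * \<kappa> k = e * q ^ (n - 1) * (1 - q ^ k)" if "k \<le> n" for n k
    using that by (cases k) (auto simp: \<kappa>_def power_add[symmetric])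
  define U where "U k = u * (1 - c * v * q ^ k) * (1 - d * v * q ^ k)" for k
  define X where "X k = (1 - q ^ k - \<kappa> k) * G k" for k
  have X_0: "X 0 = 0" by (simp add: X_def \<kappa>_def)
  have X_Suc: "X (Suc k) = U k * G k" for k
  proof -
    have "X (Suc k) = (1 - q * q ^ k) * (1 - e * q ^ k) * G (Suc k)"
      by (simp add: X_def \<kappa>_def algebra_simps)
    also have "\<dots> = U k * G k"
    proof -
      have "x * y * (A * a * (B * b) / (E * y * (Q * x)) * (u * w)) = u * a * b * (A * B / (E * Q) * w)"
        if "x \<noteq> 0" "y \<noteq> 0" for x y A B E Q a b w :: complex
        using that by simp
      then show ?thesis
        using q1[of k] e1[of k] unfolding G_def U_def qpoch_Suc power_Suc by blast
    qed
    finally show ?thesis .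
  qed
  have shift1: "(\<Sum>k\<le>Suc n. X k * h (Suc n - k)) = (\<Sum>k\<le>n. X (Suc k) * h (n - k))" for n h
    by (subst sum.atMost_Suc_shift) (simp add: X_0)
  have shift2: "(\<Sum>k\<le>Suc n. f k * p' (Suc n - k)) = (\<Sum>k\<le>n. f k * (v * p (n - k)))" for n f
    by (simp add: p'_0 Suc_diff_le p'_Suc)
  define Y where "Y k = G k * (\<kappa> k + q ^ k * (1 - e * q ^ N))" for k
  \<comment> \<open>The factor on the left splits into a part vanishing at \<open>k = 0\<close> and a part vanishing at
    \<open>k = Suc N\<close>; each of them lowers the degree of the sum by one.\<close>
  have first: "(1 - q ^ Suc N) * (1 - e * q ^ N) * P (Suc N)
      = (\<Sum>k\<le>N. G k * p (N - k) * (U k + v * (\<kappa> k + q ^ k * (1 - e * q ^ N))))"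
  proof -
    have "(1 - q ^ Suc N) * (1 - e * q ^ N) * P (Suc N)
        = (\<Sum>k\<le>Suc N. X k * p (Suc N - k) + Y k * p' (Suc N - k))"
      unfolding P_def sum_distrib_left
    proof (intro sum.cong refl)
      fix k assume "k \<in> {..Suc N}"
      then have k: "k \<le> Suc N" by simp
      have a: "q ^ Suc N = q ^ k * q ^ (Suc N - k)"
        using k by (simp flip: power_add)
      have b: "q ^ (Suc N - k) * \<kappa> k = e * q ^ N * (1 - q ^ k)" using \<kappa>[OF k] by simp
      have "(1 - q ^ k * r) * (1 - z) = (1 - q ^ k - \<kappa> k) + (\<kappa> k + q ^ k * (1 - z)) * (1 - r)"
        if "r * \<kappa> k = z * (1 - q ^ k)" for r z
        using that by (simp add: algebra_simps)
      from this[OF b, folded a]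
      show "(1 - q ^ Suc N) * (1 - e * q ^ N) * (G k * p (Suc N - k))
          = X k * p (Suc N - k) + Y k * p' (Suc N - k)"
        unfolding X_def Y_def p'_def by (simp only: distrib_left distrib_right mult_ac)
    qed
    also have "\<dots> = (\<Sum>k\<le>N. X (Suc k) * p (N - k)) + (\<Sum>k\<le>N. Y k * (v * p (N - k)))"
      by (simp only: sum.distrib shift1 shift2)
    also have "\<dots> = (\<Sum>k\<le>N. G k * p (N - k) * (U k + v * (\<kappa> k + q ^ k * (1 - e * q ^ N))))"
      by (simp add: sum.distrib[symmetric] X_Suc Y_def algebra_simps)
    finally show ?thesis .
  qed
  \<comment> \<open>For \<open>N > 0\<close>, lowering the index of \<open>p'\<close> on the left
    and that of \<open>X\<close> on the right leads to the same sum over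
    \<open>k < N\<close>.\<close>
  have second: "(\<Sum>k\<le>N. X (Suc k) * p' (N - k)) = (\<Sum>k\<le>N. v * (X k * p (N - k)))"
  proof (cases N)
    case 0
    then show ?thesis by (simp add: p'_0 X_0)
  next
    case (Suc M)
    show ?thesis
      unfolding Suc shift2 sum_distrib_left[symmetric] shift1 by (simp add: sum_distrib_left mult_ac)
  qed
  have third: "qpoch q q N * (\<Sum>k\<le>N. G k * p' (N - k)) = v * (1 - q ^ N) * Wpoly q (N - 1) c d u v"
  proof (cases N)
    case 0
    then show ?thesis by (simp add: p'_0)
  next
    case (Suc M)
    show ?thesis
      unfolding Suc shift2 W P_def by (simp add: sum_distrib_left qpoch_Suc mult_ac)
  qed
  \<comment> \<open>The summands match the desired right-hand side up to a difference that sums to 0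
    by \<open>second\<close>.\<close>
  have "(\<Sum>k\<le>N. G k * p (N - k) * (U k + v * (\<kappa> k + q ^ k * (1 - e * q ^ N))))
      = (\<Sum>k\<le>N. (u + v - q ^ N * (u * v * (c + d))) * (G k * p (N - k))
            - u * (G k * p' (N - k)) + (X (Suc k) * p' (N - k) - v * (X k * p (N - k))))"
  proof (intro sum.cong refl)
    fix k assume "k \<in> {..N}"
    then have a: "q ^ N = q ^ k * q ^ (N - k)" by (simp flip: power_add)
    have "U k + v * (\<kappa> k + q ^ k * (1 - e * (q ^ k * r)))
        = (u + v - q ^ k * r * (u * v * (c + d))) - u * (1 - r)
          + (U k * (1 - r) - v * (1 - q ^ k - \<kappa> k))" for r
      unfolding U_def e_def by (simp add: algebra_simps)
    from arg_cong[OF this[of "q ^ (N - k)"], of "\<lambda>t. G k * p (N - k) * t"]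
    show "G k * p (N - k) * (U k + v * (\<kappa> k + q ^ k * (1 - e * q ^ N)))
        = (u + v - q ^ N * (u * v * (c + d))) * (G k * p (N - k))
            - u * (G k * p' (N - k)) + (X (Suc k) * p' (N - k) - v * (X k * p (N - k)))"
      unfolding a X_Suc p'_def by (simp add: X_def algebra_simps)
  qed
  also have "\<dots> = (u + v - q ^ N * (u * v * (c + d))) * P N - u * (\<Sum>k\<le>N. G k * p' (N - k))"
    by (simp add: sum.distrib sum_subtractf second P_def sum_distrib_left)
  finally have "(1 - q ^ Suc N) * (1 - e * q ^ N) * P (Suc N)
      = (u + v - q ^ N * (u * v * (c + d))) * P N - u * (\<Sum>k\<le>N. G k * p' (N - k))"
    unfolding first .
  then have "qpoch q q N * ((1 - q ^ Suc N) * (1 - e * q ^ N) * P (Suc N))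
      = (u + v - q ^ N * (u * v * (c + d))) * (qpoch q q N * P N)
        - u * (qpoch q q N * (\<Sum>k\<le>N. G k * p' (N - k)))"
    by (simp only: right_diff_distrib mult_ac)
  then show ?thesis
    unfolding third by (simp add: W qpoch_Suc e_def mult_ac)
qed

text \<open>Moments and polynomials obey the same recurrence. Its last coefficient vanishes at index
  0 and its leading one never does, so the total mass is the only initial value.\<close>

lemma pearson_moment:
  assumes w: "pearson u v c d w" and "norm (c * d * u * v) < 1"
  shows "jackson_sum u v (\<lambda>x. w x * x ^ N) = jackson_sum u v w * Wpoly q N c d u v"
proof (induction N rule: less_induct)
  case (less N)
  show ?case
  proof (cases N)
    case 0
    then show ?thesis by (simp add: Wpoly_def qbinom_def)
  next
    case (Suc M)
    define m where "m N = jackson_sum u v (\<lambda>x. w x * x ^ N)" for N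
    have "(1 - q ^ M * (c * d * u * v)) * m (Suc M)
        = (u + v - q ^ M * (u * v * (c + d))) * m M - u * v * (1 - q ^ M) * m (M - 1)"
      using pearson_moment_recurrence[OF w] by (simp add: m_def)
    also have "m M = m 0 * Wpoly q M c d u v" using less[of M] Suc by (simp add: m_def)
    also have "m (M - 1) = m 0 * Wpoly q (M - 1) c d u v" using less[of "M - 1"] Suc by (simp add: m_def)
    also have "(u + v - q ^ M * (u * v * (c + d))) * (m 0 * Wpoly q M c d u v)
          - u * v * (1 - q ^ M) * (m 0 * Wpoly q (M - 1) c d u v)
        = m 0 * ((1 - q ^ M * (c * d * u * v)) * Wpoly q (Suc M) c d u v)"
      unfolding Wpoly_recurrence[OF assms(2)] by (simp add: algebra_simps)
    finally have "(1 - q ^ M * (c * d * u * v)) * m (Suc M)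
        = (1 - q ^ M * (c * d * u * v)) * (m 0 * Wpoly q (Suc M) c d u v)"
      by (simp add: mult_ac)
    moreover have "1 - q ^ M * (c * d * u * v) \<noteq> 0"
      using mult_q_power_neq_1[OF assms(2), of M] by (simp add: mult_ac)
    ultimately show ?thesis by (simp add: m_def Suc)
  qed
qed

definition weight :: "complex \<Rightarrow> complex \<Rightarrow> complex \<Rightarrow> complex \<Rightarrow> complex \<Rightarrow> complex" where
  "weight u v c d x = qpoch_inf q (q * x / u) * qpoch_inf q (q * x / v)
              / (qpoch_inf q (c * x) * qpoch_inf q (d * x))"

lemma pearson_weight:
  assumes "u \<noteq> 0" "v \<noteq> 0" "norm (c * u) < 1" "norm (c * v) < 1" "norm (d * u) < 1" "norm (d * v) < 1"
  shows "pearson u v c d (weight u v c d)"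
  unfolding pearson_def
proof (intro conjI ballI)
  have "(\<lambda>n. weight u v c d (s * q ^ n)) \<longlonglongrightarrow> 1 * 1 / (1 * 1)" for s
  proof -
    have "(\<lambda>n. qpoch_inf q (b * (s * q ^ n))) \<longlonglongrightarrow> 1" for b
      using qpoch_inf_tendsto_1[of "b * s"] by (simp add: mult.assoc)
    from this[of "q / u"] this[of "q / v"] this[of c] this[of d] show ?thesis
      unfolding weight_def by (intro tendsto_divide tendsto_mult) auto
  qed
  then show "(\<lambda>n. weight u v c d (u * q ^ n)) \<longlonglongrightarrow> 1" "(\<lambda>n. weight u v c d (v * q ^ n)) \<longlonglongrightarrow> 1"
    by simp_all
next
  fix x assume x: "x \<in> jackson_nodes q u v"
  have less: "norm (c * x) < 1" "norm (d * x) < 1"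
    using norm_mult_node_le[OF x, of c] norm_mult_node_le[OF x, of d] assms by auto
  have c: "qpoch_inf q (c * x) = (1 - c * x) * qpoch_inf q (c * (q * x))"
   and d: "qpoch_inf q (d * x) = (1 - d * x) * qpoch_inf q (d * (q * x))"
    using qpoch_inf_rec[of "c * x"] qpoch_inf_rec[of "d * x"] by (simp_all add: mult_ac)
  have nz: "1 - c * x \<noteq> 0" "1 - d * x \<noteq> 0" "qpoch_inf q (c * (q * x)) \<noteq> 0" "qpoch_inf q (d * (q * x)) \<noteq> 0"
    using qpoch_inf_nonzero[OF less(1)] qpoch_inf_nonzero[OF less(2)] unfolding c d by auto
  have s: "s * qpoch_inf q (q * x / s) = (s - q * x) * qpoch_inf q (q * (q * x) / s)" if "s \<noteq> 0" for s
    using qpoch_inf_rec[of "q * x / s"] that by (simp add: field_simps)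
  have "(u - q * x) * (v - q * x) * weight u v c d (q * x)
     = ((u - q * x) * qpoch_inf q (q * (q * x) / u)) * ((v - q * x) * qpoch_inf q (q * (q * x) / v))
         / (qpoch_inf q (c * (q * x)) * qpoch_inf q (d * (q * x)))"
    unfolding weight_def by (simp add: mult_ac)
  also have "\<dots> = u * v * (1 - c * x) * (1 - d * x) * weight u v c d x"
  proof -
    have "u * A * (v * B) / (C * D) = u * v * r * s * (A * B / (r * C * (s * D)))"
      if "r \<noteq> 0" "s \<noteq> 0" for A B C D r s :: complex
      using that by simp
    from this[OF nz(1,2)] show ?thesis
      unfolding s[OF assms(1), symmetric] s[OF assms(2), symmetric] unfolding weight_def c d .
  qed
  finally show "(u - q * x) * (v - q * x) * weight u v c d (q * x)
     = u * v * (1 - c * x) * (1 - d * x) * weight u v c d x" .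
qed

text \<open>The constant weight 1 satisfies the Pearson equation with \<open>c = q / u\<close> and \<open>d = q / v\<close>,
  and both it and the weight with parameters \<open>c\<close>, \<open>d\<close> lead to the case \<open>c = d = 0\<close>.\<close>

lemma jackson_sum_weight_0:
  assumes "u \<noteq> 0" "v \<noteq> 0"
  shows "jackson_sum u v (\<lambda>x. qpoch_inf q (q * x / u) * qpoch_inf q (q * x / v))
    = v * (qpoch_inf q q * qpoch_inf q (u / v) * qpoch_inf q (q * v / u))"
proof -
  have "pearson u v (q / u) (q / v) (\<lambda>x. 1)"
    using assms by (simp add: pearson_def field_simps)
  from pearson_limit[OF this] assms
  have *: "qpoch_inf q q * qpoch_inf q (q * v / u) * qpoch_inf q (q * u / v) * qpoch_inf q q
        * jackson_sum u v (\<lambda>x. 1)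
      = qpoch_inf q (q * q) * jackson_sum u v (\<lambda>x. qpoch_inf q (q * x / u) * qpoch_inf q (q * x / v))"
    by simp
  have "(\<lambda>n. (v - u) * q ^ n) sums ((v - u) * (1 / (1 - q)))"
    using norm_q_less_1 by (intro sums_mult geometric_sums)
  then have "jackson_sum u v (\<lambda>x. 1) = (v - u) / (1 - q)"
    by (simp add: jackson_term_def sums_iff)
  moreover have "v - u = v * (1 - u / v)" using assms by (simp add: field_simps)
  ultimately have one: "jackson_sum u v (\<lambda>x. 1) = v * (1 - u / v) / (1 - q)" by simp
  have uv: "qpoch_inf q (u / v) = (1 - u / v) * qpoch_inf q (q * u / v)"
    using qpoch_inf_rec[of "u / v"] by (simp add: mult_ac)
  have qq: "qpoch_inf q q = (1 - q) * qpoch_inf q (q * q)"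
    by (rule qpoch_inf_rec)
  have nz: "1 - q \<noteq> 0" "qpoch_inf q (q * q) \<noteq> 0"
    using qpoch_inf_nonzero[OF norm_q_less_1] unfolding qq by auto
  from *[symmetric] have "qpoch_inf q (q * q) * jackson_sum u v (\<lambda>x. qpoch_inf q (q * x / u) * qpoch_inf q (q * x / v))
     = qpoch_inf q (q * q) * (v * (qpoch_inf q q * qpoch_inf q (u / v) * qpoch_inf q (q * v / u)))"
    unfolding one uv using nz(1) by (simp add: qq) (simp add: mult_ac)
  with nz show ?thesis by simp
qed

text \<open>This is the Andrews-Askey q-beta integral without its prefactor
  \<open>1 - q\<close>.\<close>

lemma jackson_sum_weight:
  assumes "u \<noteq> 0" "v \<noteq> 0" "norm (c * u) < 1" "norm (c * v) < 1" "norm (d * u) < 1" "norm (d * v) < 1"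
  shows "jackson_sum u v (weight u v c d)
    = v * (qpoch_inf q q * qpoch_inf q (u / v) * qpoch_inf q (q * v / u) * qpoch_inf q (c * d * u * v))
        / (qpoch_inf q (c * u) * qpoch_inf q (c * v) * qpoch_inf q (d * u) * qpoch_inf q (d * v))"
proof -
  have "jackson_term q u v (\<lambda>x. weight u v c d x * (qpoch_inf q (c * x) * qpoch_inf q (d * x)))
      = jackson_term q u v (\<lambda>x. qpoch_inf q (q * x / u) * qpoch_inf q (q * x / v))"
  proof (rule jackson_term_cong)
    fix x assume x: "x \<in> jackson_nodes q u v"
    have "norm (c * x) < 1" "norm (d * x) < 1"
      using norm_mult_node_le[OF x, of c] norm_mult_node_le[OF x, of d] assms by auto
    then show "weight u v c d x * (qpoch_inf q (c * x) * qpoch_inf q (d * x))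
        = qpoch_inf q (q * x / u) * qpoch_inf q (q * x / v)"
      by (simp add: weight_def qpoch_inf_nonzero)
  qed
  with pearson_limit[OF pearson_weight[OF assms]] jackson_sum_weight_0[OF assms(1,2)]
  have *: "qpoch_inf q (c * u) * qpoch_inf q (c * v) * qpoch_inf q (d * u) * qpoch_inf q (d * v)
        * jackson_sum u v (weight u v c d)
      = qpoch_inf q (c * d * u * v)
        * (v * (qpoch_inf q q * qpoch_inf q (u / v) * qpoch_inf q (q * v / u)))"
    by simp
  have nz: "qpoch_inf q (c * u) * qpoch_inf q (c * v) * qpoch_inf q (d * u) * qpoch_inf q (d * v) \<noteq> 0"
    using assms by (simp add: qpoch_inf_nonzero)
  then show ?thesis
    using * unfolding nonzero_eq_divide_eq[OF nz] by (simp add: mult_ac)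
qed

end

section \<open>Coefficients of the Laguerre kernel\<close>

context nome
begin

text \<open>\<open>Q\<close> stands for \<open>q\<close> to the power \<open>\<alpha> + 1\<close>.
  The estimates below use only \<open>norm Q < 1\<close>, which keeps the choice of logarithm out of
  them.\<close>

definition phi_coeff :: "complex \<Rightarrow> complex \<Rightarrow> nat \<Rightarrow> complex" where
  "phi_coeff Q a k = q ^ (k * (k - 1)) * (- Q * a) ^ k / (qpoch q Q k * qpoch q q k)"

definition laguerre_coeff :: "complex \<Rightarrow> complex \<Rightarrow> complex \<Rightarrow> nat \<Rightarrow> complex" where
  "laguerre_coeff Q a b n = (\<Sum>k\<le>n. phi_coeff Q a k * (b ^ (n - k) / qpoch q q (n - k)))"

lemma norm_qpowr: "exp lq = q \<Longrightarrow> norm (qpowr lq s) = norm q powr s"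
  using q_nonzero by (simp add: qpowr_def powr_def norm_exp_eq_Re) (metis ln_exp norm_exp_eq_Re)

lemma qLaguerre_eq:
  assumes "exp lq = q"
  shows "qLaguerre q lq \<alpha> n a b = qpoch q q n * laguerre_coeff (qpowr lq (\<alpha> + 1)) a b n"
proof -
  define Q where "Q = qpowr lq (\<alpha> + 1)"
  have "qpowr lq (real k ^ 2 + real k * \<alpha>) = q ^ (k * (k - 1)) * Q ^ k" for k
  proof -
    have "real k ^ 2 + real k * \<alpha> = real (k * (k - 1)) + real k * (\<alpha> + 1)"
      by (cases k) (auto simp: power2_eq_square algebra_simps)
    then have "qpowr lq (real k ^ 2 + real k * \<alpha>)
        = exp (of_nat (k * (k - 1)) * lq + of_nat k * (of_real (\<alpha> + 1) * lq))"
      unfolding qpowr_def by (simp only: of_real_add of_real_mult of_real_of_nat_eq distrib_right mult.assoc)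
    also have "\<dots> = q ^ (k * (k - 1)) * Q ^ k"
      unfolding exp_add exp_of_nat_mult assms Q_def qpowr_def ..
    finally show ?thesis .
  qed
  moreover have sign: "(- Q * a) ^ k = Q ^ k * (- a) ^ k" for k
    by (simp flip: power_mult_distrib)
  ultimately show ?thesis
    unfolding qLaguerre_def laguerre_coeff_def phi_coeff_def qbinom_def sum_distrib_left
      Q_def[symmetric]
    by (intro sum.cong refl) (simp add: sign mult_ac)
qed

text \<open>Since \<open>q ^ (k * (k - 1))\<close> is the \<open>k\<close>-th power of
  \<open>q ^ (k - 1)\<close>, the terms are, up to bounded factors, \<open>k\<close>-th powers of a
  null sequence; the series is entire in \<open>t\<close>.\<close>

lemma phi_coeff_abs_summable:
  assumes "norm Q < 1"
  shows "summable (\<lambda>k. norm (phi_coeff Q a k * t ^ k))"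
proof -
  obtain C where C: "\<And>k. norm (1 / qpoch q Q k) \<le> C"
    using inverse_qpoch_bounded[OF assms] by blast
  obtain D where D: "\<And>k. norm (1 / qpoch q q k) \<le> D"
    using inverse_qpoch_bounded[OF norm_q_less_1] by blast
  have "0 \<le> C" "0 \<le> D" using order_trans[OF norm_ge_zero] C D by blast+
  have "(\<lambda>k. norm (Q * a * t * q ^ k)) \<longlonglongrightarrow> 0"
    using q_power_tendsto_0 tendsto_norm_zero by blast
  then have "(\<lambda>k. norm (Q * a * t * q ^ (k - 1))) \<longlonglongrightarrow> 0"
    by (intro LIMSEQ_imp_Suc[of "\<lambda>k. norm (Q * a * t * q ^ (k - 1))"]) simp
  then have "eventually (\<lambda>k. norm (Q * a * t * q ^ (k - 1)) < 1 / 2) sequentially"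
    by (rule order_tendstoD) simp
  then have "eventually (\<lambda>k. norm (norm (phi_coeff Q a k * t ^ k)) \<le> C * D * (1 / 2) ^ k) sequentially"
  proof eventually_elim
    case (elim k)
    have "phi_coeff Q a k * t ^ k
        = (1 / qpoch q Q k) * (1 / qpoch q q k) * (- (Q * a * t * q ^ (k - 1))) ^ k"
      by (simp add: phi_coeff_def power_mult_distrib power_mult[symmetric] mult_ac power_minus[of "_ * _"])
    also have "norm \<dots> \<le> C * D * (1 / 2) ^ k"
      unfolding norm_mult norm_power norm_minus_cancel
      using elim \<open>0 \<le> C\<close> \<open>0 \<le> D\<close> by (intro mult_mono C D power_mono) (auto simp: norm_mult norm_power)
    finally show ?case by simp
  qed
  then show ?thesis
    by (rule summable_comparison_test_ev) (intro summable_mult summable_geometric, simp)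
qed

lemma laguerre_coeff_sums:
  assumes "norm Q < 1" "norm (b * t) < 1"
  shows "(\<lambda>n. laguerre_coeff Q a b n * t ^ n) sums (1 / qpoch_inf q (b * t) * phi01 q Q (- Q * a * t))"
proof -
  have "(\<lambda>n. \<Sum>k\<le>n. phi_coeff Q a k * t ^ k * ((b * t) ^ (n - k) / qpoch q q (n - k))) sums
      ((\<Sum>k. phi_coeff Q a k * t ^ k) * (\<Sum>n. (b * t) ^ n / qpoch q q n))"
    by (rule Cauchy_product_sums[OF phi_coeff_abs_summable[OF assms(1)] q_exponential_abs_summable[OF assms(2)]])
  moreover have "(\<Sum>k\<le>n. phi_coeff Q a k * t ^ k * ((b * t) ^ (n - k) / qpoch q q (n - k)))
      = laguerre_coeff Q a b n * t ^ n" for n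
    unfolding laguerre_coeff_def sum_distrib_right
  proof (intro sum.cong refl)
    fix k assume "k \<in> {..n}"
    then have "t ^ n = t ^ k * t ^ (n - k)" by (simp flip: power_add)
    then show "phi_coeff Q a k * t ^ k * ((b * t) ^ (n - k) / qpoch q q (n - k))
        = phi_coeff Q a k * (b ^ (n - k) / qpoch q q (n - k)) * t ^ n"
      by (simp add: power_mult_distrib)
  qed
  moreover have "(\<Sum>k. phi_coeff Q a k * t ^ k) = phi01 q Q (- Q * a * t)"
    unfolding phi01_def phi_coeff_def power_mult_distrib[of "- Q * a" t]
    by (intro arg_cong[where f = suminf] ext) (simp add: mult_ac)
  moreover have "(\<Sum>n. (b * t) ^ n / qpoch q q n) = 1 / qpoch_inf q (b * t)"
    using q_exponential_sums[OF assms(2)] by (simp add: sums_iff)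
  ultimately show ?thesis by (simp add: mult_ac)
qed

lemma laguerre_kernel_sums:
  assumes "norm (qpowr lq (\<alpha> + 1)) < 1" "norm (b * x * w) < 1"
  shows "(\<lambda>n. laguerre_coeff (qpowr lq (\<alpha> + 1)) a b n * x ^ n * w ^ n)
    sums laguerre_kernel q lq \<alpha> a b x w"
  using laguerre_coeff_sums[OF assms(1), of b "x * w" a] assms(2)
  by (simp add: laguerre_kernel_def power_mult_distrib mult_ac)

text \<open>The generating series converges at \<open>1 / \<tau>\<close>, which lies inside the disc
  of radius \<open>1 / norm b\<close>, so its terms there are bounded.\<close>

lemma laguerre_coeff_bound:
  assumes "norm Q < 1" "norm b < \<tau>"
  shows "\<exists>C. \<forall>n. norm (laguerre_coeff Q a b n) \<le> C * \<tau> ^ n"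
proof -
  have \<tau>: "0 < \<tau>" using assms(2) norm_ge_zero le_less_trans by blast
  have "norm (b * of_real (1 / \<tau>)) < 1" using assms(2) \<tau> by (simp add: norm_mult norm_divide)
  from laguerre_coeff_sums[OF assms(1) this] have "summable (\<lambda>n. laguerre_coeff Q a b n * of_real (1 / \<tau>) ^ n)"
    by (rule sums_summable)
  then have "Bseq (\<lambda>n. laguerre_coeff Q a b n * of_real (1 / \<tau>) ^ n)"
    by (intro convergent_imp_Bseq convergentI[OF summable_LIMSEQ_zero])
  then obtain C where "\<And>n. norm (laguerre_coeff Q a b n * of_real (1 / \<tau>) ^ n) \<le> C"
    by (auto simp: Bseq_def)
  then show ?thesis
    using \<tau> by (intro exI[of _ C]) (simp add: norm_mult norm_power norm_divide field_simps)
qed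

text \<open>Multiplying the generating function by \<open>1 - b * t\<close> cancels the first factor
  of \<open>qpoch_inf q (b * t)\<close>, that is, it removes the potential pole at
  \<open>1 / b\<close>.\<close>

lemma laguerre_coeff_shift:
  "laguerre_coeff Q a b (Suc n) - b * laguerre_coeff Q a b n = laguerre_coeff Q a (b * q) (Suc n)"
proof -
  have step: "b ^ Suc j / qpoch q q (Suc j) - (b * q) ^ Suc j / qpoch q q (Suc j) = b * (b ^ j / qpoch q q j)" for j
  proof -
    have "1 - q * q ^ j \<noteq> 0" using mult_q_power_neq_1[OF norm_q_less_1, of j] by auto
    then show ?thesis
      using qpoch_nonzero[OF norm_q_less_1, of j]
      by (simp add: qpoch_Suc power_mult_distrib divide_simps) (simp add: algebra_simps)
  qed
  have "laguerre_coeff Q a b (Suc n) - laguerre_coeff Q a (b * q) (Suc n)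
      = (\<Sum>k\<le>Suc n. phi_coeff Q a k * (b ^ (Suc n - k) / qpoch q q (Suc n - k)
            - (b * q) ^ (Suc n - k) / qpoch q q (Suc n - k)))"
    unfolding laguerre_coeff_def by (simp add: sum_subtractf right_diff_distrib)
  also have "\<dots> = (\<Sum>k\<le>n. phi_coeff Q a k * (b ^ Suc (n - k) / qpoch q q (Suc (n - k))
            - (b * q) ^ Suc (n - k) / qpoch q q (Suc (n - k))))"
    by (simp add: Suc_diff_le)
  also have "\<dots> = b * laguerre_coeff Q a b n"
    unfolding step laguerre_coeff_def by (simp add: sum_distrib_left mult_ac)
  finally show ?thesis by (simp add: algebra_simps)
qed

text \<open>The generating function \<open>phi01 / qpoch_inf q (b * t)\<close> is meromorphic with poles among
  \<open>1 / (b * q ^ j)\<close>. If its coefficients are \<open>o(1 / s ^ n)\<close>, there is no pole on the closed disc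
  of radius \<open>s\<close>, so the decay is exponentially better. The induction removes
  the potential poles in that disc one at a time.\<close>

lemma laguerre_coeff_decay:
  assumes "norm Q < 1" "0 < s" "(\<lambda>n. laguerre_coeff Q a b n * of_real s ^ n) \<longlonglongrightarrow> 0"
  shows "\<exists>\<tau>>0. \<tau> * s < 1 \<and> (\<exists>C. \<forall>n. norm (laguerre_coeff Q a b n) \<le> C * \<tau> ^ n)"
proof -
  have "eventually (\<lambda>J. norm (b * of_real s * q ^ J) < 1) sequentially"
    using tendstoD[OF q_power_tendsto_0[of "b * of_real s"], of 1] by simp
  then obtain J where "norm (b * of_real s * q ^ J) < 1"
    by (auto simp: eventually_sequentially)
  then have "norm (b * q ^ J) * s < 1" using assms(2) by (simp add: norm_mult mult_ac)
  then show ?thesis using assms(3)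
  proof (induction J arbitrary: b)
    case 0
    then obtain \<tau> where \<tau>: "norm b < \<tau>" "\<tau> * s < 1"
      using ex_greater_mult_less_1[of s "norm b"] assms(2) by auto
    moreover have "0 < \<tau>" using \<tau> norm_ge_zero le_less_trans by blast
    ultimately show ?case
      using laguerre_coeff_bound[OF assms(1)] by blast
  next
    case (Suc J)
    define F where "F = laguerre_coeff Q a b"
    define H where "H = laguerre_coeff Q a (b * q)"
    have F_Suc: "F (Suc n) - b * F n = H (Suc n)" for n
      unfolding F_def H_def by (rule laguerre_coeff_shift)
    have F0: "(\<lambda>n. F n * of_real s ^ n) \<longlonglongrightarrow> 0" using Suc.prems by (simp add: F_def)
    show ?case
    proof (cases "norm b * s < 1")
      case True
      then obtain \<tau> where \<tau>: "norm b < \<tau>" "\<tau> * s < 1"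
        using ex_greater_mult_less_1[of s "norm b"] assms(2) by auto
      moreover have "0 < \<tau>" using \<tau> norm_ge_zero le_less_trans by blast
      ultimately show ?thesis
        using laguerre_coeff_bound[OF assms(1)] by blast
    next
      case False
      then have bs: "1 \<le> norm b * s" by simp
      then have b: "b \<noteq> 0" by auto
      have "(\<lambda>n. F (Suc n) * of_real s ^ Suc n - b * of_real s * (F n * of_real s ^ n)) \<longlonglongrightarrow> 0 - b * of_real s * 0"
        by (intro tendsto_intros F0 LIMSEQ_Suc[OF F0])
      moreover have "F (Suc n) * of_real s ^ Suc n - b * of_real s * (F n * of_real s ^ n) = H (Suc n) * of_real s ^ Suc n" for n
        unfolding F_Suc[symmetric] by (simp add: algebra_simps)
      ultimately have "(\<lambda>n. H (Suc n) * of_real s ^ Suc n) \<longlonglongrightarrow> 0" by simp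
      then have "(\<lambda>n. H n * of_real s ^ n) \<longlonglongrightarrow> 0" by (rule LIMSEQ_imp_Suc)
      moreover have "norm (b * q * q ^ J) * s < 1" using Suc.prems by (simp add: mult.assoc)
      ultimately obtain \<tau> C where \<tau>: "0 < \<tau>" "\<tau> * s < 1" and C: "\<And>n. norm (H n) \<le> C * \<tau> ^ n"
        using Suc.IH[of "b * q"] unfolding H_def by blast
      have "\<tau> * s < norm b * s" using \<tau> bs by simp
      then have \<tau>b: "\<tau> < norm b" using assms(2) by simp
      define r where "r = \<tau> / norm b"
      have r: "0 < r" "r < 1" using \<tau> \<tau>b b by (auto simp: r_def)
      \<comment> \<open>The increments of \<open>f\<close> are geometrically small, so
        \<open>f\<close> converges; its limit measures the residue at \<open>1 / b\<close>. The
        decay assumption with \<open>norm b * s\<close> at least 1 forces this limit to be 0, and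
        \<open>f m\<close> becomes minus a tail sum.\<close>
      define f where "f n = F n / b ^ n" for n
      have f_Suc: "f (Suc n) - f n = H (Suc n) / b ^ Suc n" for n
        using b by (simp add: f_def F_Suc[symmetric] field_simps)
      have "norm (f n) \<le> norm (F n * of_real s ^ n)" for n
      proof -
        have "norm (f n) * 1 \<le> norm (f n) * (norm b * s) ^ n"
          by (intro mult_left_mono one_le_power bs) simp
        also have "\<dots> = norm (F n * of_real s ^ n)"
          using b assms(2) by (simp add: f_def norm_mult norm_divide norm_power power_mult_distrib)
        finally show ?thesis by simp
      qed
      then have f0: "f \<longlonglongrightarrow> 0"
        by (intro Lim_null_comparison[OF always_eventually tendsto_norm_zero[OF F0]]) simp
      have f_bound: "norm (f m) \<le> C * r ^ Suc m / (1 - r)" for m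
      proof -
        have "(\<lambda>n. f (m + Suc n) - f (m + n)) sums (0 - f (m + 0))"
          using LIMSEQ_ignore_initial_segment[OF f0, of m]
          by (intro telescope_sums) (simp add: add.commute)
        then have s1: "(\<lambda>n. H (Suc (m + n)) / b ^ Suc (m + n)) sums (- f m)"
          using f_Suc by simp
        have s2: "(\<lambda>n. C * r ^ Suc m * r ^ n) sums (C * r ^ Suc m * (1 / (1 - r)))"
          using r by (intro sums_mult geometric_sums) simp
        have le: "norm (H (Suc (m + n)) / b ^ Suc (m + n)) \<le> C * r ^ Suc m * r ^ n" for n
          using divide_right_mono[OF C[of "Suc (m + n)"], of "norm b ^ Suc (m + n)"]
          by (simp add: norm_divide norm_mult norm_power r_def power_divide power_add)
        from norm_suminf_le[OF le sums_summable[OF s2]] show ?thesis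
          unfolding sums_unique[OF s1, symmetric] sums_unique[OF s2, symmetric] by simp
      qed
      have "norm (F n) \<le> C * r / (1 - r) * \<tau> ^ n" for n
      proof -
        have "norm (F n) = norm (f n) * norm b ^ n" using b by (simp add: f_def norm_divide norm_power)
        also have "\<dots> \<le> C * r ^ Suc n / (1 - r) * norm b ^ n"
          by (intro mult_right_mono f_bound) simp
        also have "\<dots> = C * r / (1 - r) * (r * norm b) ^ n" by (simp add: power_mult_distrib)
        also have "r * norm b = \<tau>" using b by (simp add: r_def)
        finally show ?thesis .
      qed
      with \<tau> show ?thesis unfolding F_def by blast
    qed
  qed
qed

end

section \<open>The augmentation operator and termwise integration\<close>

context nome
begin

text \<open>The q-binomial coefficients are uniformly bounded because \<open>norm q < 1\<close>, so
  beyond the rate \<open>M\<close> only the number of terms counts. Hahn polynomials and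
  \<open>Wpoly\<close> are both instances.\<close>

lemma norm_homogeneous_sum_le:
  fixes f :: "nat \<Rightarrow> complex"
  assumes "\<And>k. norm (f k) \<le> C * M ^ k" "norm s \<le> M"
  shows "\<exists>K\<ge>0. \<forall>N. norm (\<Sum>k\<le>N. qbinom q N k * f k * s ^ (N - k)) \<le> K * real (Suc N) * M ^ N"
proof -
  obtain D where D: "\<And>k. norm (1 / qpoch q q k) \<le> D" and D0: "D > 0"
    using inverse_qpoch_bounded[OF norm_q_less_1] by blast
  obtain E where E: "\<And>k. norm (qpoch q q k) \<le> E" and E0: "E > 0"
    using qpoch_bounded by blast
  have C: "0 \<le> C" using order_trans[OF norm_ge_zero assms(1)[of 0]] by simp
  have M: "0 \<le> M" using order_trans[OF norm_ge_zero assms(2)] .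
  have summand: "norm (qbinom q N k * f k * s ^ (N - k)) \<le> E * D * D * C * M ^ N" if "k \<le> N" for N k
  proof -
    have "norm (qbinom q N k) = norm (qpoch q q N) * norm (1 / qpoch q q k) * norm (1 / qpoch q q (N - k))"
      by (simp add: qbinom_def norm_mult norm_divide)
    also have "\<dots> \<le> E * D * D" using D0 E0 by (intro mult_mono D E) auto
    finally have "norm (qbinom q N k * f k * s ^ (N - k)) \<le> E * D * D * (C * M ^ k) * M ^ (N - k)"
      unfolding norm_mult norm_power using D0 E0 C M by (intro mult_mono assms power_mono) auto
    also have "\<dots> = E * D * D * C * M ^ N" using that by (simp add: mult.assoc flip: power_add)
    finally show ?thesis .
  qed
  have "norm (\<Sum>k\<le>N. qbinom q N k * f k * s ^ (N - k)) \<le> E * D * D * C * real (Suc N) * M ^ N" for N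
    using sum_norm_bound[of "{..N}", OF summand] by (simp add: mult_ac)
  moreover have "0 \<le> E * D * D * C" using D0 E0 C by simp
  ultimately show ?thesis by blast
qed

lemma hahn_bound:
  assumes "\<And>k. norm (qpoch q \<beta> k * y ^ k) \<le> C * M ^ k" "norm z \<le> M"
  shows "\<exists>K\<ge>0. \<forall>N. norm (hahn q \<beta> N y z) \<le> K * real (Suc N) * M ^ N"
  using norm_homogeneous_sum_le[of "\<lambda>k. qpoch q \<beta> k * y ^ k", OF assms]
  by (simp add: hahn_def mult_ac)

lemma Wpoly_bound:
  assumes "norm (c * d * u * v) < 1" "norm u \<le> X" "norm v \<le> X"
  shows "\<exists>K\<ge>0. \<forall>N. norm (Wpoly q N c d u v) \<le> K * real (Suc N) * X ^ N"
proof -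
  obtain D where D: "\<And>k. norm (1 / qpoch q (c * d * u * v) k) \<le> D" and D0: "D > 0"
    using inverse_qpoch_bounded[OF assms(1)] by blast
  obtain E where E: "\<And>k. norm (qpoch q (c * v) k) \<le> E" and E0: "E > 0"
    using qpoch_bounded by blast
  obtain G where G: "\<And>k. norm (qpoch q (d * v) k) \<le> G" and G0: "G > 0"
    using qpoch_bounded by blast
  have "norm (qpoch q (c * v) k * qpoch q (d * v) k / qpoch q (c * d * u * v) k * u ^ k) \<le> E * G * D * X ^ k" for k
  proof -
    have "norm (qpoch q (c * v) k * qpoch q (d * v) k / qpoch q (c * d * u * v) k * u ^ k)
      = norm (qpoch q (c * v) k) * norm (qpoch q (d * v) k) * norm (1 / qpoch q (c * d * u * v) k) * norm u ^ k"
      by (simp add: norm_mult norm_divide norm_power)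
    also have "\<dots> \<le> E * G * D * X ^ k"
      using D0 E0 G0 by (intro mult_mono D E G power_mono assms) auto
    finally show ?thesis .
  qed
  from norm_homogeneous_sum_le[OF this assms(3)] show ?thesis
    by (simp add: Wpoly_def mult_ac)
qed

text \<open>The \<open>k\<close>-th q-derivative contributes
  \<open>qpoch q q (n + k) / qpoch q q n\<close>; with the operator's own
  \<open>1 / qpoch q q k\<close> this is a q-binomial coefficient, so collecting the terms with
  \<open>n + k = N\<close> gives \<open>hahn\<close>.\<close>

lemma cauchy_aug_powser:
  assumes f: "\<And>w. norm (B * w) < 1 \<Longrightarrow> (\<lambda>n. e n * w ^ n) sums f w"
    and z: "norm (B * z) < 1"
    and e: "\<And>n. norm (e n) \<le> C * t ^ n" and t: "0 \<le> t" "t * M < 1"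
    and \<beta>: "\<And>k. norm (qpoch q \<beta> k * y ^ k) \<le> C' * M ^ k" and zM: "norm z \<le> M"
  shows "cauchy_aug_converges q \<beta> y f z"
    and "(\<lambda>N. e N * hahn q \<beta> N y z) sums cauchy_aug q \<beta> y f z"
proof -
  obtain D where D: "\<And>k. norm (1 / qpoch q q k) \<le> D" and D0: "D > 0"
    using inverse_qpoch_bounded[OF norm_q_less_1] by blast
  obtain E where E: "\<And>k. norm (qpoch q q k) \<le> E" and E0: "E > 0"
    using qpoch_bounded by blast
  have C: "0 \<le> C" "0 \<le> C'" using order_trans[OF norm_ge_zero e[of 0]] order_trans[OF norm_ge_zero \<beta>[of 0]] by simp_all
  have M: "0 \<le> M" using order_trans[OF norm_ge_zero zM] .
  define a where "a k n = qpoch q \<beta> k / qpoch q q k * (y ^ k * (qpoch q q (n + k) / qpoch q q n * e (n + k) * z ^ n))" for k n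
  have rows: "a k sums cauchy_aug_term q \<beta> y f z k" for k
    unfolding a_def cauchy_aug_term_def by (intro sums_mult qderiv_funpow_powser[OF f z])
  have bound: "norm (a k n) \<le> C' * D * E * D * C * (t * M) ^ k * (t * M) ^ n" for k n
  proof -
    have "norm (a k n) = norm (qpoch q \<beta> k * y ^ k) * norm (1 / qpoch q q k) * norm (qpoch q q (n + k))
        * norm (1 / qpoch q q n) * norm (e (n + k)) * norm z ^ n"
      by (simp add: a_def norm_mult norm_divide norm_power mult_ac)
    also have "\<dots> \<le> (C' * M ^ k) * D * E * D * (C * t ^ (n + k)) * M ^ n"
      using C D0 E0 M t by (intro mult_mono \<beta> D E e power_mono zM) auto
    also have "\<dots> = C' * D * E * D * C * (t * M) ^ k * (t * M) ^ n"
      by (simp add: power_add power_mult_distrib mult_ac)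
    finally show ?thesis .
  qed
  have "0 \<le> t * M" using t M by simp
  note ds = double_sum_diagonal[OF bound rows this t(2) this t(2)]
  show "cauchy_aug_converges q \<beta> y f z"
    unfolding cauchy_aug_converges_def by (rule ds(1))
  have "(\<Sum>k\<le>N. a k (N - k)) = e N * hahn q \<beta> N y z" for N
    unfolding hahn_def sum_distrib_left a_def qbinom_def
    by (intro sum.cong refl) (simp add: mult_ac)
  with ds(2) show "(\<lambda>N. e N * hahn q \<beta> N y z) sums cauchy_aug q \<beta> y f z"
    by (simp add: cauchy_aug_def)
qed

text \<open>The majorant \<open>B\<close> does not depend on the node, so all partial sums are
  uniformly bounded there and Tannery's theorem applies to the sequence of partial sums.\<close>

lemma jackson_sum_sums:
  assumes w: "bounded_on_nodes u v w"
    and T: "\<And>x. x \<in> jackson_nodes q u v \<Longrightarrow> (\<lambda>N. e N * x ^ N) sums T x"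
    and B: "\<And>x N. x \<in> jackson_nodes q u v \<Longrightarrow> norm (e N * x ^ N) \<le> B N" and "summable B"
  shows "bounded_on_nodes u v (\<lambda>x. w x * T x)"
    and "(\<lambda>N. e N * jackson_sum u v (\<lambda>x. w x * x ^ N)) sums jackson_sum u v (\<lambda>x. w x * T x)"
proof -
  obtain M where M: "\<And>x. x \<in> jackson_nodes q u v \<Longrightarrow> norm (w x) \<le> M"
    using w by (auto simp: bounded_on_nodes_def)
  have B0: "0 \<le> B N" for N using order_trans[OF norm_ge_zero B[of "u * q ^ 0" N]] by blast
  have partial: "norm (\<Sum>N<n. e N * x ^ N) \<le> suminf B" if "x \<in> jackson_nodes q u v" for n x
    using sum_norm_le[of "{..<n}", OF B[OF that]] sum_le_suminf[OF assms(4), of "{..<n}"] B0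
    by (meson finite_lessThan order_trans)
  have "norm (T x) \<le> suminf B" if "x \<in> jackson_nodes q u v" for x
    using T[OF that] partial[OF that] unfolding sums_def
    by (intro LIMSEQ_le_const2[OF tendsto_norm]) auto
  then have "bounded_on_nodes u v T" by (rule bounded_on_nodesI)
  then show "bounded_on_nodes u v (\<lambda>x. w x * T x)" by (intro bounded_on_nodes_mult w)
  define f where "f n x = w x * (\<Sum>N<n. e N * x ^ N)" for n x
  have f_bound: "norm (f n x) \<le> M * suminf B" if "x \<in> jackson_nodes q u v" for n x
    unfolding f_def norm_mult using that
    by (intro mult_mono M partial) (auto intro: order_trans[OF norm_ge_zero M])
  have "(\<lambda>n. jackson_sum u v (f n)) \<longlonglongrightarrow> jackson_sum u v (\<lambda>x. w x * T x)"
  proof (rule tannerys_theorem[where M = "\<lambda>m. (norm u + norm v) * (M * suminf B) * norm q ^ m", THEN conjunct2, THEN conjunct2])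
    show "(\<lambda>n. jackson_term q u v (f n) m) \<longlonglongrightarrow> jackson_term q u v (\<lambda>x. w x * T x) m" for m
      using T[OF nodes_memI(1)] T[OF nodes_memI(2)]
      unfolding jackson_term_def f_def sums_def by (intro tendsto_intros)
    show "\<forall>\<^sub>F (m, n) in sequentially \<times>\<^sub>F sequentially.
        norm (jackson_term q u v (f n) m) \<le> (norm u + norm v) * (M * suminf B) * norm q ^ m"
      using norm_jackson_term_le[OF f_bound] by (intro always_eventually) auto
    show "summable (\<lambda>m. (norm u + norm v) * (M * suminf B) * norm q ^ m)"
      using norm_q_less_1 by (intro summable_mult summable_geometric) simp
  qed simp
  moreover have "jackson_sum u v (f n) = (\<Sum>N<n. e N * jackson_sum u v (\<lambda>x. w x * x ^ N))" for n
  proof -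
    have "(\<lambda>m. \<Sum>N<n. e N * jackson_term q u v (\<lambda>x. w x * x ^ N) m) sums
        (\<Sum>N<n. e N * jackson_sum u v (\<lambda>x. w x * x ^ N))"
      by (intro sums_sum sums_mult summable_sums summable_jackson_term bounded_on_nodes_mult w
            bounded_on_nodes_power)
    moreover have "(\<Sum>N<n. e N * jackson_term q u v (\<lambda>x. w x * x ^ N) m) = jackson_term q u v (f n) m" for m
      by (simp add: jackson_term_def f_def sum_distrib_left sum_distrib_right sum_subtractf algebra_simps)
    ultimately show ?thesis by (simp add: sums_iff)
  qed
  ultimately show "(\<lambda>N. e N * jackson_sum u v (\<lambda>x. w x * x ^ N)) sums jackson_sum u v (\<lambda>x. w x * T x)"
    by (simp add: sums_def)
qed

text \<open>Since \<open>g k (q * z) = g k z - z * g (Suc k) z\<close> for \<open>g k = (qderiv q ^^ k) f\<close>, smallness of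
  \<open>y ^ k * g k z\<close> propagates along \<open>z * q ^ j\<close> to the limit \<open>0\<close>, where \<open>g k\<close> is essentially
  the coefficient \<open>e k\<close>.\<close>

lemma coeff_tendsto_0_if_cauchy_aug_converges:
  assumes f: "\<And>w. norm (B * w) < 1 \<Longrightarrow> (\<lambda>n. e n * w ^ n) sums f w"
    and z: "norm (B * z) < 1"
    and conv: "cauchy_aug_converges q \<beta> y f z"
    and \<beta>: "\<And>i. \<beta> * q ^ i \<noteq> 1" and y: "y \<noteq> 0"
  shows "(\<lambda>n. e n * y ^ n) \<longlonglongrightarrow> 0"
proof -
  define g where "g k = (qderiv q ^^ k) f" for k
  have "cauchy_aug_term q \<beta> y f z \<longlonglongrightarrow> 0"
    using conv unfolding cauchy_aug_converges_def by (rule summable_LIMSEQ_zero)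
  \<comment> \<open>As no factor \<open>1 - \<beta> * q ^ i\<close> vanishes, the operator
    coefficients stay away from 0 and can be divided out.\<close>
  then have "(\<lambda>k. qpoch q q k / qpoch q \<beta> k * cauchy_aug_term q \<beta> y f z k) \<longlonglongrightarrow>
      qpoch_inf q q / qpoch_inf q \<beta> * 0"
    by (intro tendsto_intros qpoch_tendsto qpoch_inf_nonzero' \<beta>)
  moreover have "qpoch q q k / qpoch q \<beta> k * cauchy_aug_term q \<beta> y f z k = y ^ k * g k z" for k
    using qpoch_nonzero[OF norm_q_less_1, of k] \<beta> qpoch_eq_0_iff[of \<beta> k]
    by (auto simp: cauchy_aug_term_def g_def)
  ultimately have lim: "(\<lambda>k. y ^ k * g k z) \<longlonglongrightarrow> 0" by simp
  define t where "t = norm (z / y)"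
  define A where "A = exp (t / (1 - norm q))"
  obtain D where D: "\<And>k. norm (1 / qpoch q q k) \<le> D" and D0: "D > 0"
    using inverse_qpoch_bounded[OF norm_q_less_1] by blast
  have bound: "norm (e k * y ^ k) \<le> D * (\<epsilon> * A)"
    if \<epsilon>: "\<And>k. k \<ge> K \<Longrightarrow> norm (y ^ k * g k z) \<le> \<epsilon>" and k: "k \<ge> K" for \<epsilon> K k
  proof -
    have \<epsilon>0: "0 \<le> \<epsilon>" using order_trans[OF norm_ge_zero \<epsilon>[of K]] by simp
    \<comment> \<open>Each step costs a factor \<open>1 + t * norm q ^ j\<close>; bounding it by an
      exponential keeps the product below \<open>A\<close> for every \<open>j\<close>. The step
      refers to index \<open>Suc k\<close>, so the induction treats all \<open>k \<ge> K\<close> at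
      once.\<close>
    have partial: "norm (y ^ k * g k (z * q ^ j)) \<le> \<epsilon> * exp (t * (\<Sum>i<j. norm q ^ i))" if "k \<ge> K" for j k
      using that
    proof (induction j arbitrary: k)
      case 0
      then show ?case using \<epsilon> by simp
    next
      case (Suc j)
      define w where "w = z * q ^ j"
      have rec: "g k (q * w) = g k w - w * g (Suc k) w"
        by (cases "w = 0") (auto simp: g_def qderiv_def)
      have "norm (y ^ k * g k (q * w)) = norm (y ^ k * g k w - w / y * (y ^ Suc k * g (Suc k) w))"
        unfolding rec using y by (simp add: algebra_simps)
      also have "\<dots> \<le> norm (y ^ k * g k w) + norm (w / y) * norm (y ^ Suc k * g (Suc k) w)"
        unfolding norm_mult[of "w / y", symmetric] by (rule norm_triangle_ineq4)
      also have "\<dots> \<le> \<epsilon> * exp (t * (\<Sum>i<j. norm q ^ i)) + norm (w / y) * (\<epsilon> * exp (t * (\<Sum>i<j. norm q ^ i)))"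
        using Suc.IH[of k] Suc.IH[of "Suc k"] Suc.prems
        unfolding w_def by (intro add_mono mult_left_mono) auto
      also have "norm (w / y) = t * norm q ^ j"
        by (simp add: w_def t_def norm_mult norm_divide norm_power)
      also have "\<epsilon> * exp (t * (\<Sum>i<j. norm q ^ i)) + t * norm q ^ j * (\<epsilon> * exp (t * (\<Sum>i<j. norm q ^ i)))
          = \<epsilon> * exp (t * (\<Sum>i<j. norm q ^ i)) * (1 + t * norm q ^ j)"
        by (simp add: algebra_simps)
      also have "\<dots> \<le> \<epsilon> * exp (t * (\<Sum>i<j. norm q ^ i)) * exp (t * norm q ^ j)"
        using \<epsilon>0 by (intro mult_left_mono exp_ge_add_one_self) auto
      also have "\<dots> = \<epsilon> * exp (t * (\<Sum>i<Suc j. norm q ^ i))"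
        by (simp add: exp_add distrib_left mult_ac)
      finally show ?case by (simp add: w_def mult_ac)
    qed
    have "norm (y ^ k * g k (z * q ^ j)) \<le> \<epsilon> * A" for j
    proof -
      have "(\<Sum>i<j. norm q ^ i) \<le> 1 / (1 - norm q)"
        using sum_le_suminf[of "\<lambda>i. norm q ^ i" "{..<j}"] norm_q_less_1
        by (simp add: suminf_geometric summable_geometric)
      then have "\<epsilon> * exp (t * (\<Sum>i<j. norm q ^ i)) \<le> \<epsilon> * A"
        using \<epsilon>0 mult_left_mono[of "\<Sum>i<j. norm q ^ i" "1 / (1 - norm q)" t]
        by (intro mult_left_mono) (auto simp: A_def t_def)
      then show ?thesis using partial[OF k, of j] by simp
    qed
    moreover have "(\<lambda>j. norm (y ^ k * g k (z * q ^ j))) \<longlonglongrightarrow> norm (y ^ k * (qpoch q q k * e k))"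
    proof -
      define p where "p w = (\<Sum>n. qpoch q q (n + k) / qpoch q q n * e (n + k) * w ^ n)" for w
      have g_sums: "(\<lambda>n. qpoch q q (n + k) / qpoch q q n * e (n + k) * w ^ n) sums g k w" if "norm (B * w) < 1" for w
        unfolding g_def by (rule qderiv_funpow_powser[OF f that])
      then have g_eq: "g k w = p w" if "norm (B * w) < 1" for w
        unfolding p_def using that by (intro sums_unique)
      define X where "X = (if B = 0 then 1 else 1 / (2 * B))"
      have X: "norm (B * X) < 1" "X \<noteq> 0" by (auto simp: X_def norm_mult norm_divide)
      have "isCont p 0"
        unfolding p_def using g_sums[OF X(1)] X(2)
        by (intro isCont_powser[where K = X]) (auto simp: sums_iff)
      then have "(\<lambda>j. p (z * q ^ j)) \<longlonglongrightarrow> p 0"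
        using isCont_tendsto_compose q_power_tendsto_0 by blast
      moreover have "p 0 = qpoch q q k * e k" unfolding p_def powser_zero by simp
      moreover have "g k (z * q ^ j) = p (z * q ^ j)" for j
        using norm_mult_q_power_le[of "B * z" j] z by (intro g_eq) (simp add: mult.assoc)
      ultimately show ?thesis by (auto intro!: tendsto_intros)
    qed
    ultimately have "norm (y ^ k * (qpoch q q k * e k)) \<le> \<epsilon> * A"
      by (intro LIMSEQ_le_const2) auto
    then have "norm (1 / qpoch q q k) * norm (y ^ k * (qpoch q q k * e k)) \<le> D * (\<epsilon> * A)"
      using D0 by (intro mult_mono D) auto
    then show ?thesis
      using qpoch_nonzero[OF norm_q_less_1, of k] by (simp add: norm_mult norm_divide mult_ac)
  qed
  show ?thesis
  proof (rule LIMSEQ_I)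
    fix r :: real assume r: "0 < r"
    define \<epsilon> where "\<epsilon> = r / (2 * D * A)"
    have A0: "A > 0" by (simp add: A_def)
    have \<epsilon>: "\<epsilon> > 0" using r D0 A0 by (simp add: \<epsilon>_def)
    obtain K where "\<And>k. k \<ge> K \<Longrightarrow> norm (y ^ k * g k z) < \<epsilon>"
      using LIMSEQ_D[OF lim \<epsilon>] by auto
    then have "norm (e k * y ^ k) \<le> D * (\<epsilon> * A)" if "k \<ge> K" for k
      using bound[of K \<epsilon> k] that less_imp_le by blast
    moreover have "D * (\<epsilon> * A) < r" using r D0 A0 by (simp add: \<epsilon>_def field_simps)
    ultimately show "\<exists>no. \<forall>n\<ge>no. norm (e n * y ^ n - 0) < r" by (metis diff_zero le_less_trans)
  qed
qed

end

section \<open>The integral formula\<close>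

context nome
begin

text \<open>\<open>\<tau>\<close>, \<open>X\<close> and \<open>M\<close> are the rates of the
  Laguerre coefficients, of the nodes and \<open>Wpoly\<close>, and of the operator. With
  \<open>\<tau> * (X * M) < 1\<close> every series is geometric up to a polynomial factor.\<close>

lemma jackson_integral_cauchy_aug:
  fixes lq a b c d u v y z \<beta> :: complex and \<alpha> \<tau> X M C C' :: real
  defines "Q \<equiv> qpowr lq (\<alpha> + 1)"
  assumes lq: "exp lq = q" and Q: "norm Q < 1"
    and uv: "u \<noteq> 0" "v \<noteq> 0" "norm u \<le> X" "norm v \<le> X"
    and cd: "norm (c * u) < 1" "norm (c * v) < 1" "norm (d * u) < 1" "norm (d * v) < 1"
    and bz: "norm (b * z * u) < 1" "norm (b * z * v) < 1"
    and \<tau>: "0 \<le> \<tau>" "\<And>n. norm (laguerre_coeff Q a b n) \<le> C * \<tau> ^ n"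
    and M: "\<And>k. norm (qpoch q \<beta> k * y ^ k) \<le> C' * M ^ k" "norm z \<le> M"
    and less: "\<tau> * (X * M) < 1"
  defines "S \<equiv> \<lambda>n. Wpoly q n c d u v * hahn q \<beta> n y z / qpoch q q n * qLaguerre q lq \<alpha> n a b"
    and "T \<equiv> \<lambda>x. cauchy_aug q \<beta> y (\<lambda>w. laguerre_kernel q lq \<alpha> a b x w) z"
  shows "\<forall>x\<in>jackson_nodes q u v. cauchy_aug_converges q \<beta> y (\<lambda>w. laguerre_kernel q lq \<alpha> a b x w) z"
    and "jackson_integrable q u v (\<lambda>x. weight u v c d x * T x)"
    and "summable S"
    and "jackson_integral q u v (\<lambda>x. weight u v c d x * T x)
      = (1 - q) * jackson_sum u v (weight u v c d) * suminf S"
proof -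
  define F where "F = laguerre_coeff Q a b"
  define e where "e N = F N * hahn q \<beta> N y z" for N
  have F: "norm (F n) \<le> C * \<tau> ^ n" for n using \<tau> by (simp add: F_def)
  have X: "0 \<le> X" using order_trans[OF norm_ge_zero uv(3)] .
  have M0: "0 \<le> M" using order_trans[OF norm_ge_zero M(2)] .
  have C: "0 \<le> C" using order_trans[OF norm_ge_zero F[of 0]] by simp
  define \<theta> where "\<theta> = \<tau> * (X * M)"
  have \<theta>: "0 \<le> \<theta>" "\<theta> < 1" using less \<tau> X M0 by (auto simp: \<theta>_def)
  have x_le: "norm x \<le> X" if "x \<in> jackson_nodes q u v" for x
    using norm_mult_node_le[OF that, of 1] uv by auto
  have aug: "cauchy_aug_converges q \<beta> y (\<lambda>w. laguerre_kernel q lq \<alpha> a b x w) z \<and>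
      (\<lambda>N. e N * x ^ N) sums T x" if x: "x \<in> jackson_nodes q u v" for x
  proof -
    have bxz: "norm (b * x * z) < 1"
      using norm_mult_node_le[OF x, of "b * z"] bz by (auto simp: mult_ac)
    have kernel: "(\<lambda>n. F n * x ^ n * w ^ n) sums laguerre_kernel q lq \<alpha> a b x w"
      if "norm (b * x * w) < 1" for w
      using laguerre_kernel_sums[OF Q[unfolded Q_def] that] by (simp add: F_def Q_def)
    have bound: "norm (F n * x ^ n) \<le> C * (\<tau> * X) ^ n" for n
      unfolding norm_mult norm_power power_mult_distrib mult.assoc[symmetric]
      using \<tau> C by (intro mult_mono F power_mono x_le x) auto
    have \<tau>X: "0 \<le> \<tau> * X" "\<tau> * X * M < 1" using \<tau> X less by (auto simp: mult.assoc)
    show ?thesis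
      using cauchy_aug_powser[OF kernel bxz bound \<tau>X M] by (simp add: T_def e_def mult_ac)
  qed
  then show "\<forall>x\<in>jackson_nodes q u v. cauchy_aug_converges q \<beta> y (\<lambda>w. laguerre_kernel q lq \<alpha> a b x w) z"
    by blast
  have cduv: "norm (c * d * u * v) < 1"
  proof -
    have "norm (c * u) * norm (d * v) \<le> norm (c * u) * 1"
      using cd by (intro mult_left_mono) auto
    then show ?thesis using cd(1) by (simp add: norm_mult mult_ac)
  qed
  obtain K where K: "K \<ge> 0" "\<And>N. norm (hahn q \<beta> N y z) \<le> K * real (Suc N) * M ^ N"
    using hahn_bound[OF M] by blast
  obtain L where L: "L \<ge> 0" "\<And>N. norm (Wpoly q N c d u v) \<le> L * real (Suc N) * X ^ N"
    using Wpoly_bound[OF cduv uv(3,4)] by blast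
  \<comment> \<open>Relaxing a linear factor to a quadratic one lets \<open>sm\<close> dominate both
    the integrand's series and \<open>S\<close>.\<close>
  have sq: "real (Suc N) \<le> real (Suc N) ^ 2" for N by (rule self_le_power) auto
  have sm: "summable (\<lambda>N. D * (real (Suc N) ^ 2 * \<theta> ^ N))" for D
    by (intro summable_mult summable_Suc_square_power \<theta>)
  have e_bound: "norm (e N * x ^ N) \<le> C * K * (real (Suc N) ^ 2 * \<theta> ^ N)"
    if "x \<in> jackson_nodes q u v" for x N
  proof -
    have "norm (e N * x ^ N) \<le> (C * \<tau> ^ N) * (K * real (Suc N) * M ^ N) * X ^ N"
      unfolding e_def norm_mult norm_power using C \<tau> K M0 that
      by (intro mult_mono F K power_mono x_le) auto
    also have "\<dots> = C * K * (real (Suc N) * \<theta> ^ N)"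
      by (simp add: \<theta>_def power_mult_distrib mult_ac del: of_nat_Suc)
    also have "\<dots> \<le> C * K * (real (Suc N) ^ 2 * \<theta> ^ N)"
      using C K \<theta> by (intro mult_left_mono mult_right_mono sq) auto
    finally show ?thesis .
  qed
  have S_eq: "S n = e n * Wpoly q n c d u v" for n
    using qpoch_nonzero[OF norm_q_less_1, of n]
    by (simp add: S_def e_def F_def qLaguerre_eq[OF lq] Q_def)
  have "norm (S N) \<le> C * K * L * (real (Suc N) ^ 2 * \<theta> ^ N)" for N
  proof -
    have "norm (S N) \<le> (C * \<tau> ^ N) * (K * real (Suc N) * M ^ N) * (L * real (Suc N) * X ^ N)"
      unfolding S_eq e_def norm_mult using C \<tau> K L M0 by (intro mult_mono F K L) auto
    also have "\<dots> = C * K * L * (real (Suc N) ^ 2 * \<theta> ^ N)"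
      by (simp add: \<theta>_def power_mult_distrib power2_eq_square mult_ac del: of_nat_Suc)
    finally show ?thesis .
  qed
  then show summable_S: "summable S"
    by (intro summable_comparison_test'[OF sm])
  note pw = pearson_weight[OF uv(1,2) cd]
  note js = jackson_sum_sums[OF pearson_bounded[OF pw] conjunct2[OF aug] e_bound sm]
  have bounded: "bounded_on_nodes u v (\<lambda>x. weight u v c d x * T x)"
    using js(1) by blast
  then show "jackson_integrable q u v (\<lambda>x. weight u v c d x * T x)"
    unfolding jackson_integrable_def by (rule summable_jackson_term)
  have "(\<lambda>N. e N * (jackson_sum u v (weight u v c d) * Wpoly q N c d u v)) sums
      jackson_sum u v (\<lambda>x. weight u v c d x * T x)"
    using js(2) unfolding pearson_moment[OF pw cduv] by blast
  then have "(\<lambda>N. jackson_sum u v (weight u v c d) * S N) sums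
      jackson_sum u v (\<lambda>x. weight u v c d x * T x)"
    by (simp add: S_eq mult_ac)
  moreover have "(\<lambda>N. jackson_sum u v (weight u v c d) * S N) sums
      (jackson_sum u v (weight u v c d) * suminf S)"
    using summable_S by (intro sums_mult summable_sums)
  ultimately show "jackson_integral q u v (\<lambda>x. weight u v c d x * T x)
      = (1 - q) * jackson_sum u v (weight u v c d) * suminf S"
    unfolding jackson_integral_def using sums_unique2 by (metis mult.assoc)
qed

text \<open>In each case of the convergence hypothesis there are \<open>M\<close> and \<open>\<tau>\<close> for which the
  operator sum is dominated by a geometric series. If \<open>\<beta> = 1 / q ^ i\<close> the operator is a finite sum and \<open>y\<close>
  plays no role; otherwise convergence at the node of largest norm forces the decay of
  the coefficients.\<close>

lemma ex_dominating_rates: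
  fixes a b x y z \<beta> Q :: complex
  assumes Q: "norm Q < 1" and f: "\<And>w. norm (b * x * w) < 1 \<Longrightarrow>
      (\<lambda>n. laguerre_coeff Q a b n * x ^ n * w ^ n) sums f w"
    and bz: "norm (b * z * x) < 1" and x: "x \<noteq> 0"
    and conv: "norm (b * y * x) < 1 \<or> cauchy_aug_converges q \<beta> y f z"
  shows "\<exists>\<tau> M C C'. 0 \<le> \<tau> \<and> (\<forall>n. norm (laguerre_coeff Q a b n) \<le> C * \<tau> ^ n) \<and>
      (\<forall>k. norm (qpoch q \<beta> k * y ^ k) \<le> C' * M ^ k) \<and> norm z \<le> M \<and> \<tau> * (norm x * M) < 1"
proof -
  obtain E where E: "\<And>k. norm (qpoch q \<beta> k) \<le> E" and E0: "E > 0"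
    using qpoch_bounded by blast
  have y_bound: "norm (qpoch q \<beta> k * y ^ k) \<le> E * M ^ k" if "norm y \<le> M" for M k
    unfolding norm_mult norm_power using that E0 by (intro mult_mono E power_mono) auto
  consider "norm (b * y * x) < 1" | i where "\<beta> * q ^ i = 1"
    | "\<And>i. \<beta> * q ^ i \<noteq> 1" "norm (b * y * x) \<ge> 1" "cauchy_aug_converges q \<beta> y f z"
    using conv by fastforce
  then show ?thesis
  proof cases
    case 1
    define M where "M = max (norm y) (norm z)"
    have "norm b * (norm x * M) < 1"
      using 1 bz by (auto simp: M_def max_def norm_mult mult_ac)
    moreover have M: "norm y \<le> M" "norm z \<le> M" by (auto simp: M_def)
    moreover have "0 \<le> norm x * M"
      using order_trans[OF norm_ge_zero M(1)] by simp
    ultimately obtain \<tau> where \<tau>: "norm b < \<tau>" "\<tau> * (norm x * M) < 1"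
      using ex_greater_mult_less_1 by blast
    then have "0 \<le> \<tau>" using norm_ge_zero[of b] by linarith
    with \<tau> M y_bound[OF M(1)] laguerre_coeff_bound[OF Q \<tau>(1)] show ?thesis by blast
  next
    case 2
    have "norm b * (norm x * norm z) < 1" using bz by (simp add: norm_mult mult_ac)
    then obtain \<tau> where \<tau>: "norm b < \<tau>" "\<tau> * (norm x * norm z) < 1"
      using ex_greater_mult_less_1[of "norm x * norm z" "norm b"] by auto
    then have \<tau>0: "0 \<le> \<tau>" using norm_ge_zero[of b] by linarith
    \<comment> \<open>Strictly above \<open>norm z\<close>, \<open>M\<close> is positive even for
      \<open>z = 0\<close>; the finitely many nonzero operator coefficients are then bounded by a
      multiple of \<open>M ^ k\<close>, whatever the size of \<open>y\<close>.\<close>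
    obtain M where M: "norm z < M" "M * (\<tau> * norm x) < 1"
      using ex_greater_mult_less_1[of "\<tau> * norm x" "norm z"] \<tau> \<tau>0 by (auto simp: mult_ac)
    then have M0: "0 < M" using norm_ge_zero[of z] by linarith
    have "(\<lambda>k. qpoch q \<beta> k * y ^ k / of_real M ^ k) \<longlonglongrightarrow> 0"
    proof (rule tendsto_eventually)
      show "eventually (\<lambda>k. qpoch q \<beta> k * y ^ k / of_real M ^ k = 0) sequentially"
        using 2 by (intro eventually_sequentiallyI[of "Suc i"]) (auto simp: qpoch_eq_0_iff)
    qed
    then have "Bseq (\<lambda>k. qpoch q \<beta> k * y ^ k / of_real M ^ k)"
      by (intro convergent_imp_Bseq convergentI)
    then obtain C' where "\<And>k. norm (qpoch q \<beta> k * y ^ k / of_real M ^ k) \<le> C'"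
      by (auto simp: Bseq_def)
    then have "norm (qpoch q \<beta> k * y ^ k) \<le> C' * M ^ k" for k
      using M0 by (simp add: norm_divide norm_power field_simps)
    moreover have "norm z \<le> M" "\<tau> * (norm x * M) < 1" using M by (auto simp: mult_ac)
    ultimately show ?thesis using \<tau>0 laguerre_coeff_bound[OF Q \<tau>(1)] by blast
  next
    case 3
    then have y: "y \<noteq> 0" by auto
    have "norm (b * x * z) < 1" using bz by (simp add: mult_ac)
    from coeff_tendsto_0_if_cauchy_aug_converges[OF f this 3(3,1) y]
    have "(\<lambda>n. norm (laguerre_coeff Q a b n * x ^ n * y ^ n)) \<longlonglongrightarrow> 0"
      using tendsto_norm_zero by blast
    then have "(\<lambda>n. norm (laguerre_coeff Q a b n * of_real (norm x * norm y) ^ n)) \<longlonglongrightarrow> 0"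
      by (simp add: norm_mult norm_power power_mult_distrib mult_ac)
    then have "(\<lambda>n. laguerre_coeff Q a b n * of_real (norm x * norm y) ^ n) \<longlonglongrightarrow> 0"
      by (rule tendsto_norm_zero_cancel)
    then obtain \<tau> C where \<tau>: "0 < \<tau>" "\<tau> * (norm x * norm y) < 1"
        "\<And>n. norm (laguerre_coeff Q a b n) \<le> C * \<tau> ^ n"
      using laguerre_coeff_decay[OF Q, of "norm x * norm y" a b] x y by auto
    \<comment> \<open>Here \<open>norm (b * z * x) < 1\<close> while \<open>norm (b * y * x)\<close>
      is at least 1, so \<open>norm y\<close> dominates \<open>norm z\<close> and can serve as
      \<open>M\<close>.\<close>
    have "norm (b * x) * norm z < norm (b * x) * norm y"
      using bz 3(2) by (simp add: norm_mult mult_ac)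
    then have "norm z \<le> norm y" using mult_less_cancel_left_pos norm_ge_zero
      by (metis less_eq_real_def linorder_not_le mult_left_mono)
    with \<tau> y_bound[OF order_refl] show ?thesis by (meson less_imp_le)
  qed
qed

end

theorem theorem5p5:
  fixes q lq a b c d u v y z \<beta> :: complex and \<alpha> :: real
  assumes "exp lq = q" and "0 < norm q" and "norm q < 1"
    and "\<alpha> > -1"
    and "u \<noteq> 0" and "v \<noteq> 0"
    and "Max {norm (c * u), norm (c * v), norm (d * u), norm (d * v),
              norm (b * z * u), norm (b * z * v)} < 1"
    and "max (norm (b * y * u)) (norm (b * y * v)) < 1 \<or>
         (\<forall>x \<in> jackson_nodes q u v.
            cauchy_aug_converges q \<beta> y (\<lambda>w. laguerre_kernel q lq \<alpha> a b x w) z)"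
  shows
    "(\<forall>x \<in> jackson_nodes q u v.
        cauchy_aug_converges q \<beta> y (\<lambda>w. laguerre_kernel q lq \<alpha> a b x w) z) \<and>
     jackson_integrable q u v
       (\<lambda>x. qpoch_inf q (q * x / u) * qpoch_inf q (q * x / v)
              / (qpoch_inf q (c * x) * qpoch_inf q (d * x))
            * cauchy_aug q \<beta> y (\<lambda>w. laguerre_kernel q lq \<alpha> a b x w) z) \<and>
     summable (\<lambda>n. Wpoly q n c d u v * hahn q \<beta> n y z / qpoch q q n * qLaguerre q lq \<alpha> n a b) \<and>
     jackson_integral q u v
       (\<lambda>x. qpoch_inf q (q * x / u) * qpoch_inf q (q * x / v)
              / (qpoch_inf q (c * x) * qpoch_inf q (d * x))
            * cauchy_aug q \<beta> y (\<lambda>w. laguerre_kernel q lq \<alpha> a b x w) z)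
     = (1 - q) * v
         * (qpoch_inf q q * qpoch_inf q (u / v) * qpoch_inf q (q * v / u) * qpoch_inf q (c * d * u * v))
         / (qpoch_inf q (c * u) * qpoch_inf q (c * v) * qpoch_inf q (d * u) * qpoch_inf q (d * v))
         * (\<Sum>n. Wpoly q n c d u v * hahn q \<beta> n y z / qpoch q q n * qLaguerre q lq \<alpha> n a b)"
proof -
  interpret nome q by unfold_locales (use assms in auto)
  have cd: "norm (c * u) < 1" "norm (c * v) < 1" "norm (d * u) < 1" "norm (d * v) < 1"
    and bz: "norm (b * z * u) < 1" "norm (b * z * v) < 1"
    using assms(7) by auto
  define Q where "Q = qpowr lq (\<alpha> + 1)"
  have "norm Q = norm q powr (\<alpha> + 1)" unfolding Q_def by (rule norm_qpowr[OF assms(1)])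
  also have "\<dots> < 1" using assms(2-4) powr_less_mono2[of "\<alpha> + 1" "norm q" 1] by simp
  finally have Q: "norm Q < 1" .
  \<comment> \<open>The endpoint of larger norm is itself a node (index 0), and rates valid for
    \<open>norm x\<close> are valid at every node.\<close>
  define x where "x = (if norm u \<le> norm v then v else u)"
  have x: "x \<in> jackson_nodes q u v" "x \<noteq> 0" "norm u \<le> norm x" "norm v \<le> norm x" "norm (b * z * x) < 1"
    "max (norm (b * y * u)) (norm (b * y * v)) < 1 \<Longrightarrow> norm (b * y * x) < 1"
    using assms(5,6) bz nodes_memI(1)[of u 0 v] nodes_memI(2)[of v 0 u] by (auto simp: x_def)
  have "norm (b * y * x) < 1 \<or> cauchy_aug_converges q \<beta> y (\<lambda>w. laguerre_kernel q lq \<alpha> a b x w) z"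
    using assms(8) x by blast
  from ex_dominating_rates[OF Q laguerre_kernel_sums[OF Q[unfolded Q_def], folded Q_def] x(5,2) this]
  obtain \<tau> M C C' where rates: "0 \<le> \<tau>" "\<And>n. norm (laguerre_coeff Q a b n) \<le> C * \<tau> ^ n"
    "\<And>k. norm (qpoch q \<beta> k * y ^ k) \<le> C' * M ^ k" "norm z \<le> M" "\<tau> * (norm x * M) < 1"
    by blast
  note main = jackson_integral_cauchy_aug[OF assms(1) Q[unfolded Q_def] assms(5,6) x(3,4) cd bz
      rates(1) rates(2)[unfolded Q_def] rates(3-5)]
  show ?thesis
    using main unfolding jackson_sum_weight[OF assms(5,6) cd] weight_def by (simp add: mult.assoc)
qed

end
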